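(* Let $n\ge 2$. There exist complex constants $\omega_{k,\ell}^{(m)}(\mathfrak{sl}_n)$, indexed by integers $1\le \ell\le k\le n-1$ and $1\le m\le 2\ell-1$ (with $\omega_{k,\ell}^{(m)}=0$ whenever $k+\ell-m\ge n$), such that for all $1\le \ell\le k\le n-1$, all $-k\le i\le k$ and all $-\ell\le j\le \ell$, $$[G_{k,i},G_{\ell,j}]=\sum_{m=1}^{2\ell-1}\omega_{k,\ell}^{(m)}(\mathfrak{sl}_n)\,\Phi_{k+\ell-m}^{-1}\big((m_{k,i},m_{\ell,j})_m\big),$$ where the terms with $k+\ell-m\ge n$ are omitted.
   Context: All Lie algebras are over $\mathbb{C}$. Let $(E,H,F)$ be a principal $\mathfrak{sl}_2$-triple in $\mathfrak{sl}_n=\mathfrak{sl}_n(\mathbb{C})$ (traceless $n\times n$ matrices): $[H,E]=2E$, $[H,F]=-2F$, $[E,F]=H$, and $E$ is principal nilpotent (a nilpotent matrix with a single Jordan block of size $n$). For $1\le i\le n-1$ and $-i\le j\le i$ put $G_{i,j}=\mathrm{ad}_F^{\,i-j}(E^i)$, where $E^i$ is the matrix power; these form a basis of $\mathfrak{sl}_n$. Put $V_i=\mathrm{Span}(G_{i,j}\mid -i\le j\le i)$, let $\mathcal{H}_{2i}=\mathbb{C}_{2i}[x,y]$ be the space of homogeneous polynomials of degree $2i$ in $x,y$, set $$m_{i,j}=y^{i-j}\frac{x^{i+j}}{(i+j)!}\in\mathcal{H}_{2i},$$ and let $\Phi_i:V_i\to\mathcal{H}_{2i}$ be the linear isomorphism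 with $\Phi_i(G_{i,j})=m_{i,j}$. For homogeneous polynomials $P,Q\in\mathbb{C}[x,y]$ and $m\ge 0$ at most the minimum of their degrees, the $m$-th transvectant (Cayley $\Omega$-process, without normalizing factor) is $$(P,Q)_m=\sum_{s=0}^m(-1)^s\binom{m}{s}\frac{\partial^mP}{\partial x^{m-s}\partial y^s}\,\frac{\partial^mQ}{\partial x^s\partial y^{m-s}},$$ which is homogeneous of degree $\deg P+\deg Q-2m$. *)

theory Defs
  imports "Jordan_Normal_Form.VS_Connect" "Jordan_Normal_Form.Jordan_Normal_Form"
begin

abbreviation mat_space :: "nat \<Rightarrow> (complex, complex mat) module" where
  "mat_space n \<equiv> module_mat TYPE(complex) n n"

definition sl :: "nat \<Rightarrow> complex mat set" where
  "sl n = {A \<in> carrier_mat n n. (\<Sum>i<n. A $$ (i, i)) = 0}"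

definition lie_bracket :: "complex mat \<Rightarrow> complex mat \<Rightarrow> complex mat" where
  "lie_bracket A B = A * B - B * A"

definition principal_nilpotent :: "nat \<Rightarrow> complex mat \<Rightarrow> bool" where
  "principal_nilpotent n E \<longleftrightarrow> similar_mat E (jordan_block n 0)"

definition principal_sl2_triple :: "nat \<Rightarrow> complex mat \<Rightarrow> complex mat \<Rightarrow> complex mat \<Rightarrow> bool" where
  "principal_sl2_triple n E H F \<longleftrightarrow>
     E \<in> sl n \<and> H \<in> sl n \<and> F \<in> sl n \<and>
     lie_bracket H E = 2 \<cdot>\<^sub>m E \<and>
     lie_bracket H F = (-2) \<cdot>\<^sub>m F \<and>
     lie_bracket E F = H \<and>
     principal_nilpotent n E"

definition G :: "complex mat \<Rightarrow> complex mat \<Rightarrow> nat \<Rightarrow> int \<Rightarrow> complex mat" where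
  "G E F i j = (lie_bracket F ^^ nat (int i - j)) (E ^\<^sub>m i)"

definition V :: "nat \<Rightarrow> complex mat \<Rightarrow> complex mat \<Rightarrow> nat \<Rightarrow> complex mat set" where
  "V n E F i = LinearCombinations.module.span class_ring (mat_space n)
     (G E F i ` {- int i..int i})"

text \<open>The polynomial ring in \<open>x, y\<close> over the complex numbers is represented as
  \<open>complex poly poly\<close>: \<open>x\<close> is the variable of the coefficients and \<open>y\<close> the outer variable,
  so the coefficient of the monomial with exponents \<open>a\<close> of \<open>x\<close> and \<open>b\<close> of \<open>y\<close> in \<open>P\<close> is
  \<open>coeff (coeff P b) a\<close>.\<close>

definition var_x :: "complex poly poly" where
  "var_x = [:monom 1 1:]"

definition var_y :: "complex poly poly" where
  "var_y = monom 1 1"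

abbreviation cscale :: "complex \<Rightarrow> complex poly poly \<Rightarrow> complex poly poly" where
  "cscale c P \<equiv> Polynomial.smult [:c:] P"

definition deriv_x :: "complex poly poly \<Rightarrow> complex poly poly" where
  "deriv_x P = map_poly pderiv P"

definition deriv_y :: "complex poly poly \<Rightarrow> complex poly poly" where
  "deriv_y P = pderiv P"

definition homogeneous_polys :: "nat \<Rightarrow> complex poly poly set" where
  "homogeneous_polys d = {P. \<forall>a b. coeff (coeff P b) a \<noteq> 0 \<longrightarrow> a + b = d}"

definition mpoly :: "nat \<Rightarrow> int \<Rightarrow> complex poly poly" where
  "mpoly i j = cscale (1 / fact (nat (int i + j)))
     (var_y ^ nat (int i - j) * var_x ^ nat (int i + j))"

definition transvectant ::
    "nat \<Rightarrow> complex poly poly \<Rightarrow> complex poly poly \<Rightarrow> complex poly poly" where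
  "transvectant m P Q =
     (\<Sum>s=0..m. (-1) ^ s * of_nat (m choose s) *
        (deriv_x ^^ (m - s)) ((deriv_y ^^ s) P) *
        (deriv_x ^^ s) ((deriv_y ^^ (m - s)) Q))"

text \<open>For a principal triple and \<open>1 \<le> i < n\<close> the description below determines a unique map;
  \<open>extensional\<close> only fixes its irrelevant values outside \<open>V n E F i\<close>.\<close>

definition Phi :: "nat \<Rightarrow> complex mat \<Rightarrow> complex mat \<Rightarrow> nat \<Rightarrow> complex mat \<Rightarrow> complex poly poly" where
  "Phi n E F i = (THE \<phi>.
     \<phi> \<in> extensional (V n E F i) \<and>
     (\<forall>A\<in>V n E F i. \<forall>B\<in>V n E F i. \<phi> (A + B) = \<phi> A + \<phi> B) \<and>
     (\<forall>c. \<forall>A\<in>V n E F i. \<phi> (c \<cdot>\<^sub>m A) = cscale c (\<phi> A)) \<and>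
     bij_betw \<phi> (V n E F i) (homogeneous_polys (2 * i)) \<and>
     (\<forall>j\<in>{- int i..int i}. \<phi> (G E F i j) = mpoly i j))"

definition Phi_inv :: "nat \<Rightarrow> complex mat \<Rightarrow> complex mat \<Rightarrow> nat \<Rightarrow> complex poly poly \<Rightarrow> complex mat" where
  "Phi_inv n E F i = inv_into (V n E F i) (Phi n E F i)"

end

theory Submission
  imports Defs
begin

text \<open>The brackets and the transvectants are both equivariant for \<open>sl\<^sub>2\<close>: \<open>ad F\<close> and \<open>ad E\<close>
  correspond to \<open>y \<partial>\<^sub>x\<close> and \<open>x \<partial>\<^sub>y\<close> under \<open>\<Phi>\<close>. An equivariant bilinear map on
  \<open>V\<^sub>k \<times> V\<^sub>l\<close> is determined by its value at a highest weight vector of \<open>V\<^sub>k\<close> and a lowest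
  weight vector of \<open>V\<^sub>l\<close>. There the \<open>m\<close>-th transvectant is a nonzero multiple of
  \<open>m\<^bsub>k+l-m,k-l\<^esub>\<close>, so it remains to see that \<open>[E\<^sup>k, G\<^bsub>l,-l\<^esub>]\<close> is a combination of the
  \<open>G\<^bsub>p,k-l\<^esub>\<close> with \<open>k - l < p < k + l\<close>. The upper bound holds because \<open>(ad E)\<^bsup>2l\<^esup>\<close> maps this
  bracket to a multiple of \<open>[E\<^sup>k, E\<^sup>l] = 0\<close>; the term with \<open>p = k - l\<close> vanishes because the bracket
  is trace orthogonal to \<open>F\<^bsup>k-l\<^esup>\<close>. The coefficients do not depend on the triple, since all
  principal triples are conjugate.\<close>

section \<open>Commutators and finite sums of square matrices\<close>

text \<open>\<open>Phi\<close> is a definite description on a span, so all calculations use an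
  explicit map \<open>psi\<close> on polynomials instead; it is identified with
  \<open>Phi_inv\<close> only at the end, on forms of degree 2p with p < n. The constants are
  organised by divided powers x^a y^b / (a! b!). Derivatives act on them as shifts, so the m-th
  transvectant of x^(2k)/(2k)! and y^(2l)/(2l)! is again a divided power, which \<open>psi\<close>
  sends to G_{p,k-l} / (2l-m)! with p = k+l-m. If c_q is the coefficient of G_{k-l+q,k-l} in
  [E^k, G_{l,-l}], comparison gives omega = c_{2l-m} (2l-m)! / (2l)!. Since omega is quantified
  before the triple, the c_q are read off from one concrete triple. That model also supplies the two
  facts that the sl2 relations alone do not give: weight vectors commuting with E are multiples of
  powers of E, which here stands in for complete reducibility, and tr(E^d F^d) is nonzero for d < n,
  which makes trace orthogonality detect the term p = k-l.\<close>

locale square_mats =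
  fixes n :: nat
begin

abbreviation M :: "complex mat set" where
  "M \<equiv> carrier_mat n n"

lemma M_algebra:
  assumes "A \<in> M" "B \<in> M"
  shows "C \<in> M \<Longrightarrow> A * (B + C) = A * B + A * C"
    and "C \<in> M \<Longrightarrow> (A + B) * C = A * C + B * C"
    and "C \<in> M \<Longrightarrow> A * (B - C) = A * B - A * C"
    and "C \<in> M \<Longrightarrow> (A - B) * C = A * C - B * C"
    and "A * (c \<cdot>\<^sub>m B) = c \<cdot>\<^sub>m (A * B)"
    and "(c \<cdot>\<^sub>m A) * B = c \<cdot>\<^sub>m (A * B)"
    and "c \<cdot>\<^sub>m (A + B) = c \<cdot>\<^sub>m A + c \<cdot>\<^sub>m B"
  using mult_add_distrib_mat[of A n n B n C] add_mult_distrib_mat[of A n n B C n]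
    mult_minus_distrib_mat[of A n n B n C] minus_mult_distrib_mat[of A n n B C n]
    mult_smult_distrib[of A n n B n c] mult_smult_assoc_mat[of A n n B n c]
    add_smult_distrib_left_mat[of A n n B c] assms
  by auto

lemma M_assoc: "A \<in> M \<Longrightarrow> B \<in> M \<Longrightarrow> C \<in> M \<Longrightarrow> A * B * C = A * (B * C)"
  by (rule assoc_mult_mat)

lemma lb_closed [simp, intro]: "A \<in> M \<Longrightarrow> B \<in> M \<Longrightarrow> lie_bracket A B \<in> M"
  unfolding lie_bracket_def by auto

lemma lb_funpow_closed [simp, intro]: "A \<in> M \<Longrightarrow> B \<in> M \<Longrightarrow> (lie_bracket A ^^ k) B \<in> M"
  by (induction k) auto

lemma lb_add_right:
  assumes "A \<in> M" "B \<in> M" "C \<in> M"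
  shows "lie_bracket A (B + C) = lie_bracket A B + lie_bracket A C"
proof -
  have "lie_bracket A (B + C) = (A * B + A * C) - (B * A + C * A)"
    unfolding lie_bracket_def using assms
    by (simp add: M_algebra)
  also have "\<dots> = lie_bracket A B + lie_bracket A C"
    unfolding lie_bracket_def using assms by (intro eq_matI) auto
  finally show ?thesis .
qed

lemma lb_swap:
  assumes "A \<in> M" "B \<in> M"
  shows "lie_bracket A B = - lie_bracket B A"
  unfolding lie_bracket_def using assms by (intro eq_matI) auto

lemma lb_smult_right:
  assumes "A \<in> M" "B \<in> M"
  shows "lie_bracket A (c \<cdot>\<^sub>m B) = c \<cdot>\<^sub>m lie_bracket A B"
  unfolding lie_bracket_def using assms
  by (auto simp: M_algebra right_diff_distrib
      intro!: eq_matI)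

lemma lb_smult_left:
  assumes "A \<in> M" "B \<in> M"
  shows "lie_bracket (c \<cdot>\<^sub>m A) B = c \<cdot>\<^sub>m lie_bracket A B"
  unfolding lie_bracket_def using assms
  by (auto simp: M_algebra right_diff_distrib
      intro!: eq_matI)

lemma lb_zero_right [simp]: "A \<in> M \<Longrightarrow> lie_bracket A (0\<^sub>m n n) = 0\<^sub>m n n"
  unfolding lie_bracket_def by simp

lemma lb_zero_left [simp]: "A \<in> M \<Longrightarrow> lie_bracket (0\<^sub>m n n) A = 0\<^sub>m n n"
  unfolding lie_bracket_def by simp

lemma lb_self [simp]: "A \<in> M \<Longrightarrow> lie_bracket A A = 0\<^sub>m n n"
  unfolding lie_bracket_def by simp

lemma lb_mult:
  assumes "A \<in> M" "B \<in> M" "C \<in> M"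
  shows "lie_bracket A (B * C) = lie_bracket A B * C + B * lie_bracket A C"
proof -
  have "lie_bracket A B * C + B * lie_bracket A C = 
     (A * (B * C) - B * (A * C)) + (B * (A * C) - B * C * A)"
    unfolding lie_bracket_def using assms
    by (simp add: M_algebra
         M_assoc)
  also have "\<dots> = A * (B * C) - B * C * A"
    using assms by (intro eq_matI) auto
  finally show ?thesis unfolding lie_bracket_def by simp
qed

lemma lb_eq_zero_iff: "A \<in> M \<Longrightarrow> B \<in> M \<Longrightarrow> lie_bracket A B = 0\<^sub>m n n \<longleftrightarrow> A * B = B * A"
proof
  assume c: "A \<in> M" "B \<in> M" and *: "lie_bracket A B = 0\<^sub>m n n"
  show "A * B = B * A"
  proof (rule eq_matI)
    fix i j assume ij: "i < dim_row (B * A)" "j < dim_col (B * A)"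
    have "(A * B - B * A) $$ (i,j) = 0" using * ij c unfolding lie_bracket_def by simp
    thus "(A * B) $$ (i,j) = (B * A) $$ (i,j)" using ij c by simp
  qed (use c in auto)
qed (auto simp: lie_bracket_def)

lemma lb_jacobi:
  assumes "A \<in> M" "B \<in> M" "C \<in> M"
  shows "lie_bracket A (lie_bracket B C) = lie_bracket (lie_bracket A B) C + lie_bracket B (lie_bracket A C)"
proof -
  have "lie_bracket A (lie_bracket B C) = A * (B * C) - A * (C * B) - (B * (C * A) - C * (B * A))"
    unfolding lie_bracket_def using assms
    by (simp add: M_algebra
         M_assoc)
  moreover have "lie_bracket (lie_bracket A B) C = A * (B * C) - B * (A * C) - (C * (A * B) - C * (B * A))"
    unfolding lie_bracket_def using assms
    by (simp add: M_algebra
         M_assoc)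
  moreover have "lie_bracket B (lie_bracket A C) = B * (A * C) - B * (C * A) - (A * (C * B) - C * (A * B))"
    unfolding lie_bracket_def using assms
    by (simp add: M_algebra
         M_assoc)
  ultimately show ?thesis using assms by (simp only:) (intro eq_matI, auto)
qed

lemma lb_funpow_smult:
  "A \<in> M \<Longrightarrow> B \<in> M \<Longrightarrow> (lie_bracket A ^^ k) (c \<cdot>\<^sub>m B) = c \<cdot>\<^sub>m (lie_bracket A ^^ k) B"
  by (induction k) (auto simp: lb_smult_right)

lemma lb_funpow_add:
  "A \<in> M \<Longrightarrow> B \<in> M \<Longrightarrow> C \<in> M \<Longrightarrow>
    (lie_bracket A ^^ k) (B + C) = (lie_bracket A ^^ k) B + (lie_bracket A ^^ k) C"
  by (induction k) (auto simp: lb_add_right)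

lemma lb_funpow_zero [simp]: "A \<in> M \<Longrightarrow> (lie_bracket A ^^ k) (0\<^sub>m n n) = 0\<^sub>m n n"
  by (induction k) auto

text \<open>Unlike \<^const>\<open>finsum\<close>, this sum is total in its summands, so congruence and reindexing need
  no closure conditions.\<close>

definition msum :: "('i \<Rightarrow> complex mat) \<Rightarrow> 'i set \<Rightarrow> complex mat" where
  "msum f S = mat n n (\<lambda>rc. \<Sum>s\<in>S. f s $$ rc)"

lemma msum_closed [simp, intro]: "msum f S \<in> M"
  by (simp add: msum_def)

lemma msum_empty [simp]: "msum f {} = 0\<^sub>m n n"
  by (auto simp: msum_def)

lemma msum_insert [simp]:
  "finite S \<Longrightarrow> s \<notin> S \<Longrightarrow> f s \<in> M \<Longrightarrow> msum f (insert s S) = f s + msum f S"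
  by (auto simp: msum_def intro!: eq_matI)

lemma msum_cong: "(\<And>s. s \<in> S \<Longrightarrow> f s = g s) \<Longrightarrow> msum f S = msum g S"
  by (simp add: msum_def)

lemma msum_add:
  assumes "\<And>s. s \<in> S \<Longrightarrow> f s \<in> M" "\<And>s. s \<in> S \<Longrightarrow> g s \<in> M"
  shows "msum (\<lambda>s. f s + g s) S = msum f S + msum g S"
proof (rule eq_matI)
  fix i j assume "i < dim_row (msum f S + msum g S)" "j < dim_col (msum f S + msum g S)"
  hence ij: "i < n" "j < n" by (auto simp: msum_def)
  have "(f s + g s) $$ (i, j) = f s $$ (i, j) + g s $$ (i, j)" if "s \<in> S" for s
    using assms[OF that] ij by simp
  thus "msum (\<lambda>s. f s + g s) S $$ (i, j) = (msum f S + msum g S) $$ (i, j)"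
    using ij by (simp add: msum_def sum.distrib)
qed (auto simp: msum_def)

text \<open>Only additivity, closure and the value at zero are demanded of \<open>L\<close>, so
  scaling, brackets and conjugation are all instances.\<close>

lemma msum_linear:
  assumes "finite S" "\<And>s. s \<in> S \<Longrightarrow> f s \<in> M"
    and closed: "\<And>A. A \<in> M \<Longrightarrow> L A \<in> M"
    and zero: "L (0\<^sub>m n n) = 0\<^sub>m n n"
    and add: "\<And>A B. A \<in> M \<Longrightarrow> B \<in> M \<Longrightarrow> L (A + B) = L A + L B"
  shows "L (msum f S) = msum (\<lambda>s. L (f s)) S"
  using assms(1,2) by (induction S rule: finite_induct) (auto simp: zero add closed)

lemma msum_single:
  assumes "finite S" "s \<in> S" "f s \<in> M" "\<And>t. t \<in> S \<Longrightarrow> t \<noteq> s \<Longrightarrow> f t = 0\<^sub>m n n"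
  shows "msum f S = f s"
proof (rule eq_matI)
  fix i j assume "i < dim_row (f s)" "j < dim_col (f s)"
  hence ij: "i < n" "j < n" using assms(3) by auto
  have "(\<Sum>t\<in>S. f t $$ (i, j)) = f s $$ (i, j) + (\<Sum>t\<in>S - {s}. f t $$ (i, j))"
    using assms(1,2) by (rule sum.remove)
  also have "(\<Sum>t\<in>S - {s}. f t $$ (i, j)) = 0" using ij assms(4) by (intro sum.neutral) auto
  finally show "msum f S $$ (i, j) = f s $$ (i, j)" using ij by (simp add: msum_def)
qed (use assms(3) in \<open>auto simp: msum_def\<close>)

lemma msum_eqI:
  assumes "\<And>i j. i < n \<Longrightarrow> j < n \<Longrightarrow> (\<Sum>s\<in>S. f s $$ (i, j)) = (\<Sum>t\<in>T. h t $$ (i, j))"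
  shows "msum f S = msum h T"
  using assms by (intro eq_matI) (auto simp: msum_def)

lemma smult_msum:
  "finite S \<Longrightarrow> (\<And>s. s \<in> S \<Longrightarrow> f s \<in> M) \<Longrightarrow> c \<cdot>\<^sub>m msum f S = msum (\<lambda>s. c \<cdot>\<^sub>m f s) S"
  by (rule msum_linear) (auto simp: M_algebra)

lemma lb_msum:
  "A \<in> M \<Longrightarrow> finite S \<Longrightarrow> (\<And>s. s \<in> S \<Longrightarrow> f s \<in> M) \<Longrightarrow>
    lie_bracket A (msum f S) = msum (\<lambda>s. lie_bracket A (f s)) S"
  by (rule msum_linear) (auto simp: lb_add_right)

lemma finsum_eq_msum:
  assumes "finite S" "\<And>s. s \<in> S \<Longrightarrow> f s \<in> M"
  shows "finsum (mat_space n) f S = msum f S"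
proof -
  interpret abelian_group "mat_space n" by (rule abelian_group_mat)
  show ?thesis using assms
  proof (induction S rule: finite_induct)
    case empty thus ?case using finsum_empty by (simp add: module_mat_simps)
  next
    case (insert s S)
    thus ?case by (subst finsum_insert) (auto simp: module_mat_simps)
  qed
qed

lemma pow_closed [simp, intro]: "A \<in> M \<Longrightarrow> A ^\<^sub>m k \<in> M"
  by (rule pow_carrier_mat)

lemma mult_closed [simp, intro]: "A \<in> M \<Longrightarrow> B \<in> M \<Longrightarrow> A * B \<in> M"
  by (rule mult_carrier_mat)

lemma zero_smult [simp]: "A \<in> M \<Longrightarrow> 0 \<cdot>\<^sub>m A = 0\<^sub>m n n"
  by (intro eq_matI) auto

lemma one_smult [simp]: "A \<in> M \<Longrightarrow> 1 \<cdot>\<^sub>m A = A"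
  by (intro eq_matI) auto

lemma smult_smult [simp]: "a \<cdot>\<^sub>m (b \<cdot>\<^sub>m A) = (a * b) \<cdot>\<^sub>m (A :: complex mat)"
  by (intro eq_matI) auto

lemma mult_zero_M [simp]:
  assumes "A \<in> M"
  shows "A * 0\<^sub>m n n = 0\<^sub>m n n" "0\<^sub>m n n * A = 0\<^sub>m n n"
  using right_mult_zero_mat[OF assms] left_mult_zero_mat[OF assms] by auto

lemma mult_one_M [simp]:
  assumes "A \<in> M"
  shows "A * 1\<^sub>m n = A" "1\<^sub>m n * A = A"
  using assms by auto

lemma uminus_smult: "A \<in> M \<Longrightarrow> - A = (-1) \<cdot>\<^sub>m A"
  by (intro eq_matI) auto

lemma smult_eq_zero_iff:
  assumes "A \<in> M"
  shows "c \<cdot>\<^sub>m A = 0\<^sub>m n n \<longleftrightarrow> c = 0 \<or> A = 0\<^sub>m n n"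
proof
  assume *: "c \<cdot>\<^sub>m A = 0\<^sub>m n n"
  show "c = 0 \<or> A = 0\<^sub>m n n"
  proof (cases "c = 0")
    case False
    have "A = (1 / c) \<cdot>\<^sub>m (c \<cdot>\<^sub>m A)" using False assms by simp
    thus ?thesis using * by simp
  qed simp
qed (use assms in \<open>auto intro!: eq_matI\<close>)

lemma smult_cancel:
  assumes "A \<in> M" "B \<in> M" "c \<noteq> 0" "c \<cdot>\<^sub>m A = c \<cdot>\<^sub>m B"
  shows "A = B"
proof -
  have "A = (1 / c) \<cdot>\<^sub>m (c \<cdot>\<^sub>m A)" using assms(1,3) by simp
  also have "\<dots> = (1 / c) \<cdot>\<^sub>m (c \<cdot>\<^sub>m B)" by (simp only: assms(4))
  also have "\<dots> = B" using assms(2,3) by simp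
  finally show ?thesis .
qed

lemma smult_add_smult:
  "A \<in> M \<Longrightarrow> a \<cdot>\<^sub>m A + b \<cdot>\<^sub>m A = (a + b) \<cdot>\<^sub>m A"
  by (rule add_smult_distrib_right_mat[symmetric])

lemma lb_commute_pow:
  assumes "A \<in> M" "B \<in> M" "lie_bracket A B = 0\<^sub>m n n"
  shows "lie_bracket A (B ^\<^sub>m k) = 0\<^sub>m n n"
proof (induction k)
  case 0
  thus ?case using assms by (simp add: lie_bracket_def)
next
  case (Suc k)
  thus ?case using assms by (simp add: lb_mult)
qed

lemma lb_weight_pow:
  assumes "A \<in> M" "B \<in> M" "lie_bracket A B = w \<cdot>\<^sub>m B"
  shows "lie_bracket A (B ^\<^sub>m k) = (of_nat k * w) \<cdot>\<^sub>m (B ^\<^sub>m k)"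
proof (induction k)
  case 0
  thus ?case using assms by (auto simp: lie_bracket_def intro!: eq_matI)
next
  case (Suc k)
  thus ?case using assms
    by (simp add: lb_mult M_algebra
        smult_add_smult[of "B ^\<^sub>m k * B"] algebra_simps)
qed

lemma add_left_cancel_M:
  assumes "A \<in> M" "B \<in> M" "C \<in> M" "A + C = B + C"
  shows "A = B"
proof -
  have "A = A + C - C" using assms(1,3) by (intro eq_matI) auto
  also have "\<dots> = B + C - C" by (simp only: assms(4))
  also have "\<dots> = B" using assms(2,3) by (intro eq_matI) auto
  finally show ?thesis .
qed

section \<open>Trace form and spans\<close>

definition tr :: "complex mat \<Rightarrow> complex" where
  "tr A = (\<Sum>i<n. A $$ (i, i))"

lemma tr_mult_commute:
  assumes "A \<in> M" "B \<in> M"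
  shows "tr (A * B) = tr (B * A)"
proof -
  have "tr (A * B) = (\<Sum>i<n. \<Sum>j<n. A $$ (i,j) * B $$ (j,i))"
    using assms by (auto simp: tr_def scalar_prod_def lessThan_atLeast0 intro!: sum.cong)
  also have "\<dots> = (\<Sum>j<n. \<Sum>i<n. B $$ (j,i) * A $$ (i,j))"
    by (subst sum.swap) (simp add: mult.commute)
  also have "\<dots> = tr (B * A)"
    using assms by (auto simp: tr_def scalar_prod_def lessThan_atLeast0 intro!: sum.cong)
  finally show ?thesis .
qed

lemma tr_add: "A \<in> M \<Longrightarrow> B \<in> M \<Longrightarrow> tr (A + B) = tr A + tr B"
  by (simp add: tr_def sum.distrib)

lemma tr_minus: "A \<in> M \<Longrightarrow> B \<in> M \<Longrightarrow> tr (A - B) = tr A - tr B"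
  by (simp add: tr_def sum_subtractf)

lemma tr_smult: "A \<in> M \<Longrightarrow> tr (c \<cdot>\<^sub>m A) = c * tr A"
  by (simp add: tr_def sum_distrib_left)

lemma tr_zero [simp]: "tr (0\<^sub>m n n) = 0"
  by (simp add: tr_def)

text \<open>Invariance of the trace form: a commutator with \<open>B * C\<close> is traceless, and
  \<open>lie_bracket A\<close> is a derivation.\<close>

lemma tr_lb_mult:
  assumes "A \<in> M" "B \<in> M" "C \<in> M"
  shows "tr (lie_bracket A B * C) = - tr (B * lie_bracket A C)"
proof -
  have "tr (lie_bracket A (B * C)) = 0"
    using assms by (simp add: lie_bracket_def tr_minus tr_mult_commute[of A])
  thus ?thesis using assms by (simp add: lb_mult tr_add[of "lie_bracket A B * C"] eq_neg_iff_add_eq_0)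
qed

lemma span_submodule:
  assumes "S \<subseteq> M"
  defines "N \<equiv> LinearCombinations.module.span class_ring (mat_space n) S"
  shows "submodule class_ring N (mat_space n)" "S \<subseteq> N"
    and "0\<^sub>m n n \<in> N" "\<And>A B. A \<in> N \<Longrightarrow> B \<in> N \<Longrightarrow> A + B \<in> N" "\<And>c A. A \<in> N \<Longrightarrow> c \<cdot>\<^sub>m A \<in> N"
proof -
  interpret vectorspace class_ring "mat_space n" by (rule matrix_vs)
  have S: "S \<subseteq> carrier (mat_space n)" using assms(1) by (simp add: module_mat_simps)
  show *: "submodule class_ring N (mat_space n)" unfolding N_def by (rule span_is_submodule[OF S])
  show "S \<subseteq> N" unfolding N_def by (rule in_own_span[OF S])
  show "0\<^sub>m n n \<in> N" "\<And>A B. A \<in> N \<Longrightarrow> B \<in> N \<Longrightarrow> A + B \<in> N" "\<And>c A. A \<in> N \<Longrightarrow> c \<cdot>\<^sub>m A \<in> N"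
    using submodule.zero_closed[OF *] submodule.m_closed[OF *] submodule.smult_closed[OF *]
    by (auto simp: module_mat_simps class_ring_simps)
qed

text \<open>Serves as the induction principle for spans: \<open>N\<close> is later the image of
  \<open>psi p\<close>, or the set on which two candidates for \<open>Phi\<close> agree.\<close>

lemma span_least:
  assumes "N \<subseteq> M" "S \<subseteq> N" "0\<^sub>m n n \<in> N"
    and "\<And>A B. A \<in> N \<Longrightarrow> B \<in> N \<Longrightarrow> A + B \<in> N" "\<And>c A. A \<in> N \<Longrightarrow> c \<cdot>\<^sub>m A \<in> N"
  shows "LinearCombinations.module.span class_ring (mat_space n) S \<subseteq> N"
proof -
  interpret vectorspace class_ring "mat_space n" by (rule matrix_vs)
  have "submodule class_ring N (mat_space n)"
    by (rule submodule.intro) (use assms in \<open>auto simp: module_mat_simps class_ring_simps module_axioms\<close>)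
  thus ?thesis using assms(2) by (intro span_is_subset) auto
qed

end

section \<open>The adjoint action of an \<open>sl\<^sub>2\<close>-triple\<close>

locale sl2_triple = square_mats +
  fixes E H F :: "complex mat"
  assumes E_closed [simp, intro]: "E \<in> M"
    and H_closed [simp, intro]: "H \<in> M"
    and F_closed [simp, intro]: "F \<in> M"
    and lb_H_E: "lie_bracket H E = 2 \<cdot>\<^sub>m E"
    and lb_H_F: "lie_bracket H F = (-2) \<cdot>\<^sub>m F"
    and lb_E_F: "lie_bracket E F = H"
begin

text \<open>\<open>G\<close> indexed by the number of applications of \<open>ad F\<close> instead of
  the weight, which allows induction on \<open>b\<close> and values of \<open>b\<close> beyond
  2p.\<close>

definition g :: "nat \<Rightarrow> nat \<Rightarrow> complex mat" where
  "g p b = (lie_bracket F ^^ b) (E ^\<^sub>m p)"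

lemma g_closed [simp, intro]: "g p b \<in> M"
  by (simp add: g_def)

lemma g_0: "g p 0 = E ^\<^sub>m p"
  by (simp add: g_def)

lemma lb_F_g: "lie_bracket F (g p b) = g p (Suc b)"
  by (simp add: g_def)

lemma weight_lb_F:
  assumes "X \<in> M" "lie_bracket H X = w \<cdot>\<^sub>m X"
  shows "lie_bracket H (lie_bracket F X) = (w - 2) \<cdot>\<^sub>m lie_bracket F X"
  using assms by (simp add: lb_jacobi[of H F X] lb_H_F lb_smult_left lb_smult_right
      smult_add_smult[of "lie_bracket F X"])

lemma weight_lb_E:
  assumes "X \<in> M" "lie_bracket H X = w \<cdot>\<^sub>m X"
  shows "lie_bracket H (lie_bracket E X) = (w + 2) \<cdot>\<^sub>m lie_bracket E X"
  using assms by (simp add: lb_jacobi[of H E X] lb_H_E lb_smult_left lb_smult_right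
      smult_add_smult[of "lie_bracket E X"] add.commute)

lemma weight_lb_E_funpow:
  assumes "X \<in> M" "lie_bracket H X = w \<cdot>\<^sub>m X"
  shows "lie_bracket H ((lie_bracket E ^^ k) X) = (w + 2 * of_nat k) \<cdot>\<^sub>m (lie_bracket E ^^ k) X"
  using assms
proof (induction k)
  case (Suc k)
  show ?case using weight_lb_E[OF _ Suc.IH[OF Suc.prems]] Suc.prems by (simp add: algebra_simps)
qed auto

lemma lb_E_pow_E: "lie_bracket E (E ^\<^sub>m p) = 0\<^sub>m n n"
  by (simp add: lb_commute_pow)

lemma weight_g: "lie_bracket H (g p b) = (2 * of_nat p - 2 * of_nat b) \<cdot>\<^sub>m g p b"
proof (induction b)
  case 0
  thus ?case using lb_weight_pow[OF _ _ lb_H_E, of p] by (simp add: g_def mult.commute)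
next
  case (Suc b)
  show ?case using weight_lb_F[OF _ Suc.IH] by (simp add: lb_F_g algebra_simps)
qed

text \<open>The usual relation for a highest weight vector of weight 2p: moving E past each F adds
  one of the weights 2p, 2p-2, ..., and their sum is the coefficient. It vanishes for
  \<open>b = 0\<close>, so the truncated \<open>b - 1\<close> is harmless.\<close>

lemma lb_E_g: "lie_bracket E (g p b) = (of_nat b * (2 * of_nat p - of_nat b + 1)) \<cdot>\<^sub>m g p (b - 1)"
proof (induction b)
  case 0
  thus ?case by (simp add: g_def lb_E_pow_E)
next
  case (Suc b)
  have "lie_bracket E (g p (Suc b)) = lie_bracket H (g p b) + lie_bracket F (lie_bracket E (g p b))"
    by (simp add: lb_F_g[symmetric] lb_jacobi[of E F] lb_E_F)
  also have "lie_bracket F (lie_bracket E (g p b)) = (of_nat b * (2 * of_nat p - of_nat b + 1)) \<cdot>\<^sub>m g p b"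
    unfolding Suc.IH by (cases b) (simp_all add: lb_smult_right lb_F_g smult_eq_zero_iff)
  finally show ?case
    by (simp add: weight_g smult_add_smult algebra_simps)
qed

lemma lb_E_funpow_g:
  assumes "b \<le> c" "c \<le> 2 * p"
  shows "\<exists>K. K \<noteq> 0 \<and> (lie_bracket E ^^ b) (g p c) = K \<cdot>\<^sub>m g p (c - b)"
  using assms(1)
proof (induction b)
  case 0
  thus ?case by (intro exI[of _ 1]) auto
next
  case (Suc b)
  then obtain K where K: "K \<noteq> 0" "(lie_bracket E ^^ b) (g p c) = K \<cdot>\<^sub>m g p (c - b)" by auto
  let ?L = "of_nat (c - b) * (2 * of_nat p - of_nat (c - b) + 1) :: complex"
  \<comment> \<open>The bound \<open>c \<le> 2 * p\<close> makes the subtraction exact, so that the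
    factor is a product of positive natural numbers.\<close>
  have "?L = of_nat (c - b) * of_nat (2 * p - (c - b) + 1)"
    using Suc.prems assms(2) of_nat_diff[of "c - b" "2 * p", where ?'a = complex]
    by (simp del: of_nat_diff)
  also have "\<dots> \<noteq> 0" using Suc.prems by (simp only: mult_eq_0_iff of_nat_eq_0_iff) simp
  finally have "?L \<noteq> 0" .
  thus ?case using K by (intro exI[of _ "K * ?L"]) (simp add: lb_smult_right lb_E_g del: of_nat_diff)
qed

end

section \<open>The standard principal triple\<close>

context square_mats begin

text \<open>The triple in the basis \<open>v, F v, F\<^sup>2 v, \<dots>\<close> generated by a highest weight vector \<open>v\<close> of
  weight \<open>n - 1\<close>.\<close>

definition E0 :: "complex mat" where
  "E0 = mat n n (\<lambda>(r, c). if c = Suc r then of_nat (c * (n - c)) else 0)"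

definition F0 :: "complex mat" where
  "F0 = mat n n (\<lambda>(r, c). if r = Suc c then 1 else 0)"

definition H0 :: "complex mat" where
  "H0 = mat n n (\<lambda>(r, c). if r = c then of_nat n - 1 - 2 * of_nat r else 0)"

lemma std_closed [simp, intro]: "E0 \<in> M" "F0 \<in> M" "H0 \<in> M"
  by (auto simp: E0_def F0_def H0_def)

lemma std_dim:
  "dim_row E0 = n" "dim_col E0 = n" "dim_row F0 = n" "dim_col F0 = n" "dim_row H0 = n" "dim_col H0 = n"
  by (simp_all add: E0_def F0_def H0_def)

lemma index_mult_M:
  "A \<in> M \<Longrightarrow> B \<in> M \<Longrightarrow> i < n \<Longrightarrow> j < n \<Longrightarrow> (A * B) $$ (i, j) = (\<Sum>k<n. A $$ (i, k) * B $$ (k, j))"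
  by (auto simp: scalar_prod_def lessThan_atLeast0 intro!: sum.cong)

text \<open>Otherwise the simplifier turns entries of products into scalar products before the entry
  rules for the standard triple can match.\<close>

declare index_mult_mat(1) [simp del]

lemma index_mult_E0:
  assumes "Y \<in> M" "r < n" "c < n"
  shows "(Y * E0) $$ (r, c) = (if c = 0 then 0 else Y $$ (r, c - 1) * of_nat (c * (n - c)))"
proof -
  have "(Y * E0) $$ (r, c) = (\<Sum>k<n. if k = c - 1 \<and> c \<noteq> 0 then Y $$ (r, k) * of_nat (c * (n - c)) else 0)"
    unfolding index_mult_M[OF assms(1) std_closed(1) assms(2,3)] using assms
    by (intro sum.cong) (auto simp: E0_def)
  thus ?thesis using assms by auto
qed

lemma index_E0_mult:
  assumes "Y \<in> M" "r < n" "c < n"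
  shows "(E0 * Y) $$ (r, c) = (if Suc r < n then of_nat (Suc r * (n - Suc r)) * Y $$ (Suc r, c) else 0)"
proof -
  have "(E0 * Y) $$ (r, c) = (\<Sum>k<n. if k = Suc r then of_nat (Suc r * (n - Suc r)) * Y $$ (Suc r, c) else 0)"
    unfolding index_mult_M[OF std_closed(1) assms] using assms
    by (intro sum.cong) (auto simp: E0_def)
  thus ?thesis using assms by auto
qed

lemma index_mult_F0:
  assumes "Y \<in> M" "r < n" "c < n"
  shows "(Y * F0) $$ (r, c) = (if Suc c < n then Y $$ (r, Suc c) else 0)"
proof -
  have "(Y * F0) $$ (r, c) = (\<Sum>k<n. if k = Suc c then Y $$ (r, Suc c) else 0)"
    unfolding index_mult_M[OF assms(1) std_closed(2) assms(2,3)] using assms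
    by (intro sum.cong) (auto simp: F0_def)
  thus ?thesis using assms by auto
qed

lemma index_mult_H0:
  assumes "Y \<in> M" "r < n" "c < n"
  shows "(Y * H0) $$ (r, c) = Y $$ (r, c) * (of_nat n - 1 - 2 * of_nat c)"
proof -
  have "(Y * H0) $$ (r, c) = (\<Sum>k<n. if k = c then Y $$ (r, c) * (of_nat n - 1 - 2 * of_nat c) else 0)"
    unfolding index_mult_M[OF assms(1) std_closed(3) assms(2,3)] using assms
    by (intro sum.cong) (auto simp: H0_def)
  thus ?thesis using assms by auto
qed

lemma index_H0_mult:
  assumes "Y \<in> M" "r < n" "c < n"
  shows "(H0 * Y) $$ (r, c) = (of_nat n - 1 - 2 * of_nat r) * Y $$ (r, c)"
proof -
  have "(H0 * Y) $$ (r, c) = (\<Sum>k<n. if k = r then (of_nat n - 1 - 2 * of_nat r) * Y $$ (r, c) else 0)"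
    unfolding index_mult_M[OF std_closed(3) assms] using assms
    by (intro sum.cong) (auto simp: H0_def)
  thus ?thesis using assms by auto
qed

lemma index_E0_pow:
  assumes "r < n" "c < n"
  shows "(E0 ^\<^sub>m d) $$ (r, c) = (if c = r + d then of_nat (\<Prod>t=1..d. (r + t) * (n - (r + t))) else 0)"
  using assms
proof (induction d arbitrary: c)
  case 0
  thus ?case by (auto simp: E0_def)
next
  case (Suc d)
  have "(E0 ^\<^sub>m Suc d) $$ (r, c) =
     (if c = 0 then 0 else (E0 ^\<^sub>m d) $$ (r, c - 1) * of_nat (c * (n - c)))"
    using Suc.prems by (simp add: index_mult_E0 del: of_nat_mult)
  also have "\<dots> = (if c = r + Suc d then of_nat (\<Prod>t=1..Suc d. (r + t) * (n - (r + t))) else 0)"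
    using Suc.IH[of "c - 1"] Suc.prems by (auto simp: mult_ac simp del: of_nat_diff)
  finally show ?case .
qed

lemma index_F0_pow:
  assumes "r < n" "c < n"
  shows "(F0 ^\<^sub>m d) $$ (r, c) = (if r = c + d then 1 else 0)"
  using assms
proof (induction d arbitrary: c)
  case 0
  thus ?case by (auto simp: F0_def)
next
  case (Suc d)
  thus ?case by (auto simp: index_mult_F0)
qed

lemma E0_pow_zero: "p \<ge> n \<Longrightarrow> E0 ^\<^sub>m p = 0\<^sub>m n n"
  using pow_closed[OF std_closed(1), of p] by (auto simp: index_E0_pow std_dim intro!: eq_matI)

lemma E0_pow_nonzero: "p < n \<Longrightarrow> (E0 ^\<^sub>m p) $$ (0, p) \<noteq> 0"
  by (auto simp: index_E0_pow simp del: of_nat_prod of_nat_diff of_nat_mult)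

text \<open>No cancellation can occur: the trace is the image of a sum of natural numbers, and the
  summand at \<open>r = 0\<close> is positive since \<open>d < n\<close>.\<close>

lemma tr_E0_pow_F0_pow:
  assumes "d < n"
  shows "tr (E0 ^\<^sub>m d * F0 ^\<^sub>m d) \<noteq> 0"
proof -
  have "tr (E0 ^\<^sub>m d * F0 ^\<^sub>m d) = (\<Sum>r<n. \<Sum>k<n. (E0 ^\<^sub>m d) $$ (r, k) * (F0 ^\<^sub>m d) $$ (k, r))"
    unfolding tr_def by (intro sum.cong) (auto simp: index_mult_M[OF pow_closed pow_closed])
  also have "\<dots> = (\<Sum>r<n. \<Sum>k<n. if k = r + d then of_nat (\<Prod>t=1..d. (r + t) * (n - (r + t))) else 0)"
    by (intro sum.cong) (auto simp: index_E0_pow index_F0_pow)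
  also have "\<dots> = of_nat (\<Sum>r<n. if r + d < n then \<Prod>t=1..d. (r + t) * (n - (r + t)) else 0)"
    by (auto intro!: sum.cong simp: if_distrib[of of_nat] cong: if_cong)
  also have "\<dots> \<noteq> 0"
  proof -
    have "(\<Prod>t=1..d. (0 + t) * (n - (0 + t))) > 0" using assms by (auto intro!: prod_pos)
    hence "(\<Sum>r<n. if r + d < n then \<Prod>t=1..d. (r + t) * (n - (r + t)) else 0) > 0"
      using assms by (intro sum_pos2[of _ 0]) auto
    thus ?thesis by (simp only: of_nat_eq_0_iff)
  qed
  finally show ?thesis .
qed

text \<open>The superdiagonal of \<open>E0\<close> has no zero entry, so row r of the equation
  expresses row r+1 of \<open>Z\<close> through row r; the first row determines everything.\<close>

lemma E0_commutant_zero: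
  assumes "Z \<in> M" "E0 * Z = Z * E0" "\<And>c. c < n \<Longrightarrow> Z $$ (0, c) = 0"
  shows "Z = 0\<^sub>m n n"
proof -
  have "\<forall>c<n. Z $$ (r, c) = 0" if "r < n" for r
    using that
  proof (induction r)
    case (Suc r)
    show ?case
    proof (intro allI impI)
      fix c assume c: "c < n"
      have "(E0 * Z) $$ (r, c) = (Z * E0) $$ (r, c)" by (simp add: assms(2))
      hence "of_nat (Suc r * (n - Suc r)) * Z $$ (Suc r, c) = 0"
        using Suc c assms(1) by (auto simp: index_mult_E0 index_E0_mult simp del: of_nat_diff of_nat_mult split: if_splits)
      moreover have "(of_nat (Suc r * (n - Suc r)) :: complex) \<noteq> 0"
        using Suc.prems by (simp only: of_nat_eq_0_iff) simp
      ultimately show "Z $$ (Suc r, c) = 0" by (simp only: mult_eq_0_iff) simp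
    qed
  qed (use assms(3) in auto)
  thus ?thesis using assms(1) by (intro eq_matI) auto
qed

text \<open>Entry (0,c) of a matrix has \<open>ad H0\<close>-weight 2c, so the first row of a weight
  vector has a single nonzero entry, say at e. A multiple of the e-th power of \<open>E0\<close> has
  the same first row, and \<open>E0_commutant_zero\<close> applies to the difference.\<close>

lemma std_centralizer:
  assumes X: "X \<in> M" "lie_bracket E0 X = 0\<^sub>m n n" "lie_bracket H0 X = w \<cdot>\<^sub>m X"
  shows "X = 0\<^sub>m n n \<or> (\<exists>e c. e < n \<and> w = 2 * of_nat e \<and> X = c \<cdot>\<^sub>m (E0 ^\<^sub>m e))"
proof (cases "X = 0\<^sub>m n n")
  case False
  have comm: "E0 * X = X * E0" using X by (simp add: lb_eq_zero_iff)
  then obtain e where e: "e < n" "X $$ (0, e) \<noteq> 0" using E0_commutant_zero[OF X(1)] False by blast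
  have row: "X $$ (0, c) = 0 \<or> w = 2 * of_nat c" if "c < n" for c
  proof -
    have "(H0 * X) $$ (0, c) - (X * H0) $$ (0, c) = lie_bracket H0 X $$ (0, c)"
      unfolding lie_bracket_def using X(1) that by (simp add: std_dim del: index_mult_mat(1))
    also have "\<dots> = w * X $$ (0, c)" using X that by simp
    finally have "(2 * of_nat c - w) * X $$ (0, c) = 0"
      using that X by (simp add: index_mult_H0 index_H0_mult algebra_simps)
    thus ?thesis by auto
  qed
  define c where "c = X $$ (0, e) / (E0 ^\<^sub>m e) $$ (0, e)"
  have w: "w = 2 * of_nat e" using row[OF e(1)] e by auto
  define Z where "Z = X - c \<cdot>\<^sub>m (E0 ^\<^sub>m e)"
  have ZM: "Z \<in> M" unfolding Z_def by (intro minus_carrier_mat smult_carrier_mat) simp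
  have pc: "E0 * E0 ^\<^sub>m e = E0 ^\<^sub>m e * E0"
    using lb_commute_pow[of E0 E0 e] by (simp add: lb_eq_zero_iff)
  have "E0 * Z = Z * E0"
    using X comm pc by (simp add: Z_def M_algebra del: pow_mat.simps)
  moreover have "Z $$ (0, c') = 0" if "c' < n" for c'
  proof -
    have *: "(X - c \<cdot>\<^sub>m A) $$ (0, c') = X $$ (0, c') - c * A $$ (0, c')" if "A \<in> M" for A
      using that \<open>c' < n\<close> by simp
    have "Z $$ (0, c') = X $$ (0, c') - c * (E0 ^\<^sub>m e) $$ (0, c')"
      unfolding Z_def by (rule *) simp
    thus ?thesis using that e row[OF that] w E0_pow_nonzero[OF e(1)]
      by (cases "c' = e") (auto simp: c_def index_E0_pow[of 0 c'])
  qed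
  ultimately have "Z = 0\<^sub>m n n" by (intro E0_commutant_zero ZM)
  hence "X = c \<cdot>\<^sub>m (E0 ^\<^sub>m e)"
  proof -
    have "X = Z + c \<cdot>\<^sub>m (E0 ^\<^sub>m e)" using X(1) by (auto simp: Z_def std_dim intro!: eq_matI)
    thus ?thesis using \<open>Z = 0\<^sub>m n n\<close> by simp
  qed
  thus ?thesis using w e by blast
qed simp

end

section \<open>Principal triples as conjugates of the standard one\<close>

locale conj_mats = square_mats +
  fixes W W' :: "complex mat"
  assumes W_closed [simp, intro]: "W \<in> M" and W'_closed [simp, intro]: "W' \<in> M"
    and W_W': "W * W' = 1\<^sub>m n" and W'_W: "W' * W = 1\<^sub>m n"
begin

definition cj :: "complex mat \<Rightarrow> complex mat" where
  "cj X = W * X * W'"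

lemma cj_closed [simp, intro]: "X \<in> M \<Longrightarrow> cj X \<in> M"
  by (simp add: cj_def)

lemma cj_mult:
  assumes "X \<in> M" "Y \<in> M"
  shows "cj (X * Y) = cj X * cj Y"
proof -
  have "cj X * cj Y = W * (X * (W' * W * (Y * W')))"
    using assms by (simp add: cj_def M_assoc)
  also have "\<dots> = cj (X * Y)"
    using assms by (simp add: W'_W cj_def M_assoc)
  finally show ?thesis by simp
qed

lemma cj_add: "X \<in> M \<Longrightarrow> Y \<in> M \<Longrightarrow> cj (X + Y) = cj X + cj Y"
  by (simp add: cj_def M_algebra)

lemma cj_minus: "X \<in> M \<Longrightarrow> Y \<in> M \<Longrightarrow> cj (X - Y) = cj X - cj Y"
  by (simp add: cj_def M_algebra)

lemma cj_smult: "X \<in> M \<Longrightarrow> cj (c \<cdot>\<^sub>m X) = c \<cdot>\<^sub>m cj X"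
  by (simp add: cj_def M_algebra)

lemma cj_zero [simp]: "cj (0\<^sub>m n n) = 0\<^sub>m n n"
  by (simp add: cj_def)

lemma cj_lb: "X \<in> M \<Longrightarrow> Y \<in> M \<Longrightarrow> cj (lie_bracket X Y) = lie_bracket (cj X) (cj Y)"
  by (simp add: lie_bracket_def cj_minus cj_mult)

lemma cj_lb_funpow:
  "X \<in> M \<Longrightarrow> Y \<in> M \<Longrightarrow> cj ((lie_bracket X ^^ k) Y) = (lie_bracket (cj X) ^^ k) (cj Y)"
  by (induction k) (auto simp: cj_lb)

lemma cj_pow: "X \<in> M \<Longrightarrow> cj (X ^\<^sub>m k) = cj X ^\<^sub>m k"
proof (induction k)
  case 0
  thus ?case using carrier_matD[OF W_closed] by (simp add: cj_def W_W')
qed (simp add: cj_mult)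

lemma cj_msum:
  "finite S \<Longrightarrow> (\<And>s. s \<in> S \<Longrightarrow> f s \<in> M) \<Longrightarrow> cj (msum f S) = msum (\<lambda>s. cj (f s)) S"
  by (rule msum_linear) (auto simp: cj_add)

lemma cj_surj:
  assumes "X \<in> M"
  shows "\<exists>Y \<in> M. X = cj Y"
proof
  show "X = cj (W' * X * W)"
    using assms by (simp add: cj_def M_assoc[symmetric] W_W')
      (simp add: M_assoc W_W')
qed (use assms in auto)

lemma cj_inj:
  assumes "X \<in> M" "Y \<in> M" "cj X = cj Y"
  shows "X = Y"
proof -
  have *: "W' * cj Z * W = Z" if "Z \<in> M" for Z
    using that by (simp add: cj_def M_assoc[symmetric] W'_W)
      (simp add: M_assoc W'_W)
  have "X = W' * cj X * W" by (rule *[OF assms(1), symmetric])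
  also have "\<dots> = W' * cj Y * W" by (simp only: assms(3))
  also have "\<dots> = Y" by (rule *[OF assms(2)])
  finally show ?thesis .
qed

lemma tr_cj:
  assumes "X \<in> M"
  shows "tr (cj X) = tr X"
proof -
  have "tr (cj X) = tr (W' * (W * X))" using assms by (simp add: cj_def tr_mult_commute[of "W * X"])
  also have "W' * (W * X) = X"
    using assms by (simp add: M_assoc[symmetric] W'_W)
  finally show ?thesis .
qed

end

text \<open>Principality takes the form of an explicit conjugation from the standard triple, through
  which the centralizer and trace computations are transported.
  \<open>principal_triple_exists\<close> supplies \<open>W\<close> and \<open>W'\<close>.\<close>

locale principal_triple = sl2_triple n E H F + conj_mats n W W' for n E H F W W' +
  assumes E_eq: "E = cj E0" and F_eq: "F = cj F0" and H_eq: "H = cj H0"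
begin

lemma centralizer:
  assumes X: "X \<in> M" "lie_bracket E X = 0\<^sub>m n n" "lie_bracket H X = w \<cdot>\<^sub>m X"
  shows "X = 0\<^sub>m n n \<or> (\<exists>e c. e < n \<and> w = 2 * of_nat e \<and> X = c \<cdot>\<^sub>m (E ^\<^sub>m e))"
proof -
  obtain Y where Y: "Y \<in> M" "X = cj Y" using cj_surj[OF X(1)] by auto
  have "cj (lie_bracket E0 Y) = cj (0\<^sub>m n n)" using X Y by (simp add: cj_lb E_eq)
  hence 1: "lie_bracket E0 Y = 0\<^sub>m n n" using Y by (intro cj_inj[of "lie_bracket E0 Y"]) auto
  have "cj (lie_bracket H0 Y) = cj (w \<cdot>\<^sub>m Y)" using X Y by (simp add: cj_lb cj_smult H_eq)
  hence 2: "lie_bracket H0 Y = w \<cdot>\<^sub>m Y" using Y by (intro cj_inj[of "lie_bracket H0 Y"]) auto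
  show ?thesis using std_centralizer[OF Y(1) 1 2] Y
    by (auto simp: cj_smult cj_pow E_eq)
qed

lemma E_pow_zero: "p \<ge> n \<Longrightarrow> E ^\<^sub>m p = 0\<^sub>m n n"
  by (simp add: E_eq cj_pow[symmetric] E0_pow_zero)

lemma E_pow_nonzero:
  assumes "p < n"
  shows "E ^\<^sub>m p \<noteq> 0\<^sub>m n n"
proof
  assume "E ^\<^sub>m p = 0\<^sub>m n n"
  hence "cj (E0 ^\<^sub>m p) = cj (0\<^sub>m n n)" by (simp add: E_eq cj_pow)
  hence "E0 ^\<^sub>m p = 0\<^sub>m n n" by (rule cj_inj[rotated 2]) auto
  thus False using E0_pow_nonzero[OF assms] assms by simp
qed

lemma tr_E_pow_F_pow: "d < n \<Longrightarrow> tr (E ^\<^sub>m d * F ^\<^sub>m d) \<noteq> 0"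
  using tr_E0_pow_F0_pow[of d] by (simp add: E_eq F_eq cj_pow[symmetric] cj_mult[symmetric] tr_cj)

text \<open>At \<open>b = 2p + 1\<close> the coefficient in \<open>lb_E_g\<close> is zero, so the
  vector commutes with E. Its weight -2p-2 is negative, whereas nonzero weight vectors in the
  centralizer have weights 2e with e natural.\<close>

lemma g_beyond:
  assumes "b > 2 * p"
  shows "g p b = 0\<^sub>m n n"
  using assms
proof (induction b)
  case (Suc b)
  show ?case
  proof (cases "b = 2 * p")
    case True
    have "lie_bracket E (g p (Suc b)) = 0\<^sub>m n n" by (simp add: lb_E_g True)
    moreover have "2 * of_nat p - 2 * of_nat (Suc b) \<noteq> (2 * of_nat e :: complex)" for e
    proof
      assume "2 * of_nat p - 2 * of_nat (Suc b) = (2 * of_nat e :: complex)"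
      hence "(of_nat (2 * p) :: complex) = of_nat (2 * Suc b + 2 * e)" by (simp add: algebra_simps)
      hence "2 * p = 2 * Suc b + 2 * e" by (simp only: of_nat_eq_iff)
      thus False using Suc.prems by simp
    qed
    ultimately show ?thesis using centralizer[OF g_closed _ weight_g, of p "Suc b"] by blast
  next
    case False
    thus ?thesis using Suc by (simp add: lb_F_g[symmetric])
  qed
qed simp

text \<open>By induction: \<open>(ad E)\<^bsup>r\<^esup> X\<close> commutes with \<open>E\<close> and has weight \<open>2(d + r)\<close>, hence is a
  multiple of \<open>E\<^bsup>d+r\<^esup>\<close>; the image of \<open>g (d + r) r\<close> is a nonzero multiple.\<close>

lemma expansion:
  assumes "X \<in> M" "lie_bracket H X = (2 * of_nat d) \<cdot>\<^sub>m X" "(lie_bracket E ^^ r) X = 0\<^sub>m n n"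
  shows "\<exists>c. X = msum (\<lambda>q. c q \<cdot>\<^sub>m g (d + q) q) {..<r}"
  using assms
proof (induction r arbitrary: X)
  case (Suc r)
  define Y where "Y = (lie_bracket E ^^ r) X"
  have YM: "Y \<in> M" and EY: "lie_bracket E Y = 0\<^sub>m n n" using Suc.prems by (simp_all add: Y_def)
  have "lie_bracket H Y = (2 * of_nat (d + r)) \<cdot>\<^sub>m Y"
    using weight_lb_E_funpow[OF Suc.prems(1,2)] by (simp add: Y_def)
  from centralizer[OF YM EY this] obtain a where a: "Y = a \<cdot>\<^sub>m (E ^\<^sub>m (d + r))"
  proof
    assume "Y = 0\<^sub>m n n" thus thesis by (intro that[of 0]) simp
  next
    assume "\<exists>e c. e < n \<and> 2 * of_nat (d + r) = (2 * of_nat e :: complex) \<and> Y = c \<cdot>\<^sub>m (E ^\<^sub>m e)"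
    then obtain e c where "2 * of_nat (d + r) = (2 * of_nat e :: complex)" "Y = c \<cdot>\<^sub>m (E ^\<^sub>m e)" by blast
    moreover from this have "d + r = e" by (simp only: mult_cancel_left of_nat_eq_iff) simp
    ultimately show thesis using that by blast
  qed
  obtain K where K: "K \<noteq> 0" "(lie_bracket E ^^ r) (g (d + r) r) = K \<cdot>\<^sub>m g (d + r) 0"
    using lb_E_funpow_g[of r r "d + r"] by auto
  define Z where "Z = X + (- a / K) \<cdot>\<^sub>m g (d + r) r"
  have ZM: "Z \<in> M" using Suc.prems by (simp add: Z_def)
  have "lie_bracket H Z = (2 * of_nat d) \<cdot>\<^sub>m Z"
    using Suc.prems unfolding Z_def
    by (simp add: lb_add_right lb_smult_right weight_g M_algebra mult.commute)
  moreover have "(lie_bracket E ^^ r) Z = 0\<^sub>m n n"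
    using Suc.prems K(1) a unfolding Z_def
    by (simp add: lb_funpow_add lb_funpow_smult K(2) Y_def[symmetric] g_0 smult_add_smult)
  ultimately obtain c where c: "Z = msum (\<lambda>q. c q \<cdot>\<^sub>m g (d + q) q) {..<r}"
    using Suc.IH[OF ZM] by blast
  define c' where "c' = c(r := a / K)"
  have "X = (a / K) \<cdot>\<^sub>m g (d + r) r + Z" using Suc.prems(1) carrier_matD[OF g_closed] unfolding Z_def
    by (intro eq_matI) auto
  also have "Z = msum (\<lambda>q. c' q \<cdot>\<^sub>m g (d + q) q) {..<r}" 
    unfolding c by (intro msum_cong) (auto simp: c'_def)
  also have "(a / K) \<cdot>\<^sub>m g (d + r) r + \<dots> = msum (\<lambda>q. c' q \<cdot>\<^sub>m g (d + q) q) {..<Suc r}"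
    unfolding lessThan_Suc by (subst msum_insert) (auto simp: c'_def)
  finally show ?case by blast
qed simp

lemma bracket_expansion:
  assumes "1 \<le> l" "l \<le> k" "k < n"
  shows "\<exists>c. lie_bracket (g k 0) (g l (2 * l)) = msum (\<lambda>q. c q \<cdot>\<^sub>m g (k - l + q) q) {1..2 * l - 1}"
proof -
  define d where "d = k - l"
  define X where "X = lie_bracket (g k 0) (g l (2 * l))"
  have XM: "X \<in> M" by (simp add: X_def)
  have "lie_bracket H X = (2 * of_nat d) \<cdot>\<^sub>m X"
    using assms unfolding X_def d_def
    by (simp add: lb_jacobi[of H] weight_g lb_smult_left lb_smult_right smult_add_smult[of "lie_bracket _ _"] of_nat_diff algebra_simps)
  \<comment> \<open>\<open>ad E\<close> kills \<open>g k 0\<close>, so the derivation rule leaves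
    only the term acting on the second argument.\<close>
  moreover have "(lie_bracket E ^^ b) X = lie_bracket (g k 0) ((lie_bracket E ^^ b) (g l (2 * l)))" for b
    unfolding X_def by (induction b) (simp_all add: lb_jacobi[of E "g k 0"] lb_E_g)
  from this[of "2 * l"] have "(lie_bracket E ^^ (2 * l)) X = 0\<^sub>m n n"
  proof -
    obtain K where K: "(lie_bracket E ^^ (2 * l)) (g l (2 * l)) = K \<cdot>\<^sub>m g l 0"
      using lb_E_funpow_g[of "2 * l" "2 * l" l] by auto
    have "lie_bracket E (E ^\<^sub>m l) = 0\<^sub>m n n" by (rule lb_E_pow_E)
    hence "lie_bracket (E ^\<^sub>m l) E = 0\<^sub>m n n" by (simp add: lb_eq_zero_iff)
    hence "lie_bracket (E ^\<^sub>m l) (E ^\<^sub>m k) = 0\<^sub>m n n" by (simp add: lb_commute_pow)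
    hence "lie_bracket (g k 0) (g l 0) = 0\<^sub>m n n" by (simp add: lb_eq_zero_iff g_0)
    thus ?thesis using \<open>(lie_bracket E ^^ (2 * l)) X = _\<close> K by (simp add: lb_smult_right)
  qed
  ultimately obtain c where c: "X = msum (\<lambda>q. c q \<cdot>\<^sub>m g (d + q) q) {..<2 * l}"
    using expansion[OF XM] by blast
  have F_Fd: "lie_bracket F (F ^\<^sub>m d) = 0\<^sub>m n n" by (simp add: lb_commute_pow)
  \<comment> \<open>The lowest weight vector commutes with F, hence with its powers. Invariance of
    the trace form moves the bracket with it onto the d-th power of F, where it vanishes.\<close>
  have "lie_bracket F (g l (2 * l)) = 0\<^sub>m n n" by (simp add: lb_F_g g_beyond)
  hence "lie_bracket (g l (2 * l)) F = 0\<^sub>m n n" by (simp add: lb_eq_zero_iff)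
  hence "lie_bracket (g l (2 * l)) (F ^\<^sub>m d) = 0\<^sub>m n n" by (simp add: lb_commute_pow)
  hence "tr (lie_bracket (g l (2 * l)) (g k 0) * F ^\<^sub>m d) = 0"
    by (simp add: tr_lb_mult)
  moreover have "X = (-1) \<cdot>\<^sub>m lie_bracket (g l (2 * l)) (g k 0)"
    unfolding X_def by (subst lb_swap) (auto simp: uminus_smult)
  ultimately have "tr (X * F ^\<^sub>m d) = 0"
    by (simp add: M_algebra tr_smult)
  \<comment> \<open>For positive \<open>q\<close> the vector lies in the image of
    \<open>ad F\<close>, which is orthogonal to everything commuting with F. The pairing therefore
    isolates \<open>c 0\<close>.\<close>
  moreover have "tr (g (d + q) q * F ^\<^sub>m d) = 0" if q: "q \<noteq> 0" for q
  proof -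
    obtain q' where "q = Suc q'" using q not0_implies_Suc by blast
    thus ?thesis using F_Fd by (simp add: lb_F_g[symmetric] tr_lb_mult)
  qed
  moreover have split: "X = c 0 \<cdot>\<^sub>m g d 0 + msum (\<lambda>q. c q \<cdot>\<^sub>m g (d + q) q) {1..2 * l - 1}"
  proof -
    have "{..<2 * l} = insert 0 {1..2 * l - 1}" using assms by auto
    thus ?thesis unfolding c by simp
  qed
  moreover have "tr (msum f S * F ^\<^sub>m d) = (\<Sum>s\<in>S. tr (f s * F ^\<^sub>m d))"
    if "finite S" "\<And>s. s \<in> S \<Longrightarrow> f s \<in> M" for f and S :: "nat set"
    using that by (induction S rule: finite_induct)
      (auto simp: M_algebra tr_add)
  ultimately have "c 0 * tr (E ^\<^sub>m d * F ^\<^sub>m d) = 0"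
    by (simp add: M_algebra tr_add
      M_algebra tr_smult g_0)
  hence "c 0 = 0" using tr_E_pow_F_pow[of d] assms by (auto simp: d_def)
  hence "X = msum (\<lambda>q. c q \<cdot>\<^sub>m g (d + q) q) {1..2 * l - 1}"
    using split by simp
  thus ?thesis unfolding X_def d_def by blast
qed

end

section \<open>Conjugacy of principal triples and uniform coefficients\<close>

context square_mats begin

lemma mult_vec_commutator:
  assumes "A \<in> M" "B \<in> M" "u \<in> carrier_vec n"
  shows "A *\<^sub>v (B *\<^sub>v u) = B *\<^sub>v (A *\<^sub>v u) + lie_bracket A B *\<^sub>v u"
proof -
  have "A * B = B * A + lie_bracket A B"
    unfolding lie_bracket_def using assms by (intro eq_matI) auto
  hence "A *\<^sub>v (B *\<^sub>v u) = (B * A + lie_bracket A B) *\<^sub>v u"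
    using assms by (simp add: assoc_mult_mat_vec[symmetric])
  also have "\<dots> = B *\<^sub>v (A *\<^sub>v u) + lie_bracket A B *\<^sub>v u"
    using assms by (simp add: add_mult_distrib_mat_vec[of _ n n])
  finally show ?thesis .
qed

lemma smult_mult_vec: "A \<in> M \<Longrightarrow> u \<in> carrier_vec n \<Longrightarrow> (c \<cdot>\<^sub>m A) *\<^sub>v u = c \<cdot>\<^sub>v (A *\<^sub>v u)"
  by (intro eq_vecI) auto

text \<open>Intertwining relations can be checked column by column on \<open>W\<close>, without
  knowing the entries of \<open>W'\<close>.\<close>

lemma principal_tripleI:
  assumes T: "sl2_triple n E H F" and C: "conj_mats n W W'"
    and "E * W = W * E0" "H * W = W * H0" "F * W = W * F0"
  shows "principal_triple n E H F W W'"
proof -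
  interpret T: sl2_triple n E H F by fact
  interpret C: conj_mats n W W' by fact
  have *: "A = C.cj B" if "A \<in> M" "B \<in> M" "A * W = W * B" for A B
  proof -
    have "C.cj B = A * W * W'" using that by (simp add: C.cj_def)
    also have "\<dots> = A" using that(1) by (simp add: M_assoc C.W_W')
    finally show ?thesis ..
  qed
  show ?thesis by unfold_locales (auto intro!: * assms)
qed

lemma principal_triple_E0: "principal_triple n E0 H0 F0 (1\<^sub>m n) (1\<^sub>m n)"
proof (rule principal_tripleI)
  have "lie_bracket H0 E0 = 2 \<cdot>\<^sub>m E0"
  proof (rule eq_matI)
    fix r c assume "r < dim_row (2 \<cdot>\<^sub>m E0)" "c < dim_col (2 \<cdot>\<^sub>m E0)"
    hence rc: "r < n" "c < n" by (auto simp: std_dim)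
    have "lie_bracket H0 E0 $$ (r, c) = (H0 * E0) $$ (r, c) - (E0 * H0) $$ (r, c)"
      unfolding lie_bracket_def using rc by (simp add: std_dim)
    thus "lie_bracket H0 E0 $$ (r, c) = (2 \<cdot>\<^sub>m E0) $$ (r, c)"
      using rc by (simp add: index_H0_mult index_mult_H0 std_dim) (simp add: E0_def algebra_simps)
  qed (auto simp: std_dim lie_bracket_def)
  moreover have "lie_bracket H0 F0 = (-2) \<cdot>\<^sub>m F0"
  proof (rule eq_matI)
    fix r c assume "r < dim_row ((-2) \<cdot>\<^sub>m F0)" "c < dim_col ((-2) \<cdot>\<^sub>m F0)"
    hence rc: "r < n" "c < n" by (auto simp: std_dim)
    have "lie_bracket H0 F0 $$ (r, c) = (H0 * F0) $$ (r, c) - (F0 * H0) $$ (r, c)"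
      unfolding lie_bracket_def using rc by (simp add: std_dim)
    thus "lie_bracket H0 F0 $$ (r, c) = ((-2) \<cdot>\<^sub>m F0) $$ (r, c)"
      using rc by (simp add: index_H0_mult index_mult_H0 std_dim) (simp add: F0_def algebra_simps)
  qed (auto simp: std_dim lie_bracket_def)
  moreover have "lie_bracket E0 F0 = H0"
  proof (rule eq_matI)
    fix r c assume "r < dim_row H0" "c < dim_col H0"
    hence rc: "r < n" "c < n" by (auto simp: std_dim)
    have "lie_bracket E0 F0 $$ (r, c) = (E0 * F0) $$ (r, c) - (F0 * E0) $$ (r, c)"
      unfolding lie_bracket_def using rc by (simp add: std_dim)
    also have "(E0 * F0) $$ (r, c) = (if Suc c < n \<and> r = c then of_nat (Suc c * (n - Suc c)) else 0)"
      using rc unfolding index_mult_F0[OF std_closed(1) rc] by (auto simp: E0_def)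
    also have "(F0 * E0) $$ (r, c) = (if c \<noteq> 0 \<and> r = c then of_nat (c * (n - c)) else 0)"
      using rc unfolding index_mult_E0[OF std_closed(2) rc] by (auto simp: F0_def)
    also have "(if Suc c < n \<and> r = c then of_nat (Suc c * (n - Suc c)) else 0) - \<dots> = H0 $$ (r, c)"
    proof (cases "r = c")
      case True
      \<comment> \<open>At the borders \<open>Suc c = n\<close> and \<open>c = 0\<close> the product
        formulas vanish by themselves, so the case distinctions disappear; then (c+1)(n-c-1) -
        c(n-c) = n-1-2c.\<close>
      have "(if Suc c < n then of_nat (Suc c * (n - Suc c)) else 0) = (of_nat (Suc c) * (of_nat n - of_nat (Suc c)) :: complex)"
        using rc by (cases "Suc c = n") (auto simp: of_nat_diff simp del: mult_Suc of_nat_Suc)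
      moreover have "(if c \<noteq> 0 then of_nat (c * (n - c)) else 0) = (of_nat c * (of_nat n - of_nat c) :: complex)"
        using rc by (auto simp: of_nat_diff)
      ultimately show ?thesis using True rc by (simp add: H0_def algebra_simps)
    qed (use rc in \<open>simp add: H0_def\<close>)
    finally show "lie_bracket E0 F0 $$ (r, c) = H0 $$ (r, c)" .
  qed (auto simp: std_dim lie_bracket_def)
  ultimately show "sl2_triple n E0 H0 F0" by unfold_locales auto
qed (unfold_locales, auto)

text \<open>The coefficients are those of the standard triple; conjugation preserves brackets,
  powers and linear combinations. Having \<open>c\<close> before the triple is what later makes
  \<omega> independent of it.\<close>

lemma universal_bracket_expansion:
  assumes "1 \<le> l" "l \<le> k" "k < n"
  shows "\<exists>c. \<forall>E H F W W'. principal_triple n E H F W W' \<longrightarrow>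
    lie_bracket (E ^\<^sub>m k) ((lie_bracket F ^^ (2 * l)) (E ^\<^sub>m l)) =
      msum (\<lambda>q. c q \<cdot>\<^sub>m (lie_bracket F ^^ q) (E ^\<^sub>m (k - l + q))) {1..2 * l - 1}"
proof -
  interpret S: principal_triple n E0 H0 F0 "1\<^sub>m n" "1\<^sub>m n" by (rule principal_triple_E0)
  obtain c where c: "lie_bracket (E0 ^\<^sub>m k) ((lie_bracket F0 ^^ (2 * l)) (E0 ^\<^sub>m l)) =
      msum (\<lambda>q. c q \<cdot>\<^sub>m (lie_bracket F0 ^^ q) (E0 ^\<^sub>m (k - l + q))) {1..2 * l - 1}"
    using S.bracket_expansion[OF assms] by (auto simp: S.g_def)
  show ?thesis
  proof (intro exI[of _ c] allI impI)
    fix E H F W W' assume "principal_triple n E H F W W'"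
    then interpret T: principal_triple n E H F W W' .
    have "T.cj (lie_bracket (E0 ^\<^sub>m k) ((lie_bracket F0 ^^ (2 * l)) (E0 ^\<^sub>m l))) =
      T.cj (msum (\<lambda>q. c q \<cdot>\<^sub>m (lie_bracket F0 ^^ q) (E0 ^\<^sub>m (k - l + q))) {1..2 * l - 1})"
      by (simp only: c)
    thus "lie_bracket (E ^\<^sub>m k) ((lie_bracket F ^^ (2 * l)) (E ^\<^sub>m l)) =
      msum (\<lambda>q. c q \<cdot>\<^sub>m (lie_bracket F ^^ q) (E ^\<^sub>m (k - l + q))) {1..2 * l - 1}"
      by (simp add: T.cj_lb T.cj_lb_funpow T.cj_pow T.cj_msum T.cj_smult
          T.E_eq[symmetric] T.F_eq[symmetric])
  qed
qed

lemma index_jordan_mult: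
  assumes "Y \<in> M" "r < n" "c < n"
  shows "(jordan_block n 0 * Y) $$ (r, c) = (if Suc r < n then Y $$ (Suc r, c) else 0)"
proof -
  have "(jordan_block n 0 * Y) $$ (r, c) = (\<Sum>k<n. if k = Suc r then Y $$ (Suc r, c) else 0)"
    unfolding index_mult_M[OF jordan_block_carrier assms] using assms
    by (intro sum.cong) auto
  thus ?thesis by auto
qed

lemma index_mult_jordan:
  assumes "Y \<in> M" "r < n" "c < n"
  shows "(Y * jordan_block n 0) $$ (r, c) = (if c = 0 then 0 else Y $$ (r, c - 1))"
proof -
  have "(Y * jordan_block n 0) $$ (r, c) = (\<Sum>k<n. if k = c - 1 \<and> c \<noteq> 0 then Y $$ (r, c - 1) else 0)"
    unfolding index_mult_M[OF assms(1) jordan_block_carrier assms(2,3)] using assms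
    by (intro sum.cong) auto
  thus ?thesis using assms by auto
qed

text \<open>Entrywise, [H,J] = 2J kills the first column below the diagonal and makes the diagonal
  fall in steps of 2; trace zero then fixes the top entry. No more than this column is claimed,
  because the relation leaves H free up to the centralizer of J.\<close>

lemma jordan_weight_first_col:
  assumes "n > 0" "H \<in> M" "lie_bracket H (jordan_block n 0) = 2 \<cdot>\<^sub>m jordan_block n 0" "tr H = 0" "r < n"
  shows "H $$ (r, 0) = (if r = 0 then of_nat n - 1 else 0)"
proof -
  let ?J = "jordan_block n 0 :: complex mat"
  have *: "(H * ?J) $$ (r, c) - (?J * H) $$ (r, c) = 2 * ?J $$ (r, c)" if "r < n" "c < n" for r c
  proof -
    have "lie_bracket H ?J $$ (r, c) = (2 \<cdot>\<^sub>m ?J) $$ (r, c)" by (simp only: assms(3))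
    thus ?thesis unfolding lie_bracket_def using that assms(2) by (simp)
  qed
  have lower: "H $$ (Suc r, 0) = 0" if "Suc r < n" for r
    using *[of r 0] that assms(1,2) by (simp add: index_jordan_mult index_mult_jordan split: if_splits)
  have step: "H $$ (Suc r, Suc r) = H $$ (r, r) - 2" if "Suc r < n" for r
    using *[of r "Suc r"] that assms(2)
    by (simp add: index_jordan_mult index_mult_jordan algebra_simps)
  have diag: "H $$ (r, r) = H $$ (0, 0) - 2 * of_nat r" if "r < n" for r
    using that by (induction r) (auto simp: step)
  have sum: "(\<Sum>i<m. H $$ (0, 0) - 2 * of_nat i) = of_nat m * (H $$ (0, 0) - of_nat m + 1)" for m
    by (induction m) (auto simp: algebra_simps)
  have "tr H = (\<Sum>i<n. H $$ (0, 0) - 2 * of_nat i)"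
    unfolding tr_def by (intro sum.cong refl diag) simp
  hence "of_nat n * (H $$ (0, 0) - of_nat n + 1) = 0" using assms(4) by (simp only: sum)
  hence "H $$ (0, 0) - of_nat n + 1 = 0" using assms(1) by (simp only: mult_eq_0_iff of_nat_eq_0_iff) simp
  hence "H $$ (0, 0) = of_nat n - 1" by (simp add: algebra_simps)
  thus ?thesis using lower[of "r - 1"] assms(5) by (cases r) auto
qed

text \<open>The trace of \<open>H\<close> forces the weight \<open>n - 1\<close> on the kernel of \<open>E\<close>, and the vectors
  \<open>F\<^sup>i e\<^sub>0\<close> form a triangular basis.\<close>

lemma jordan_principal_triple:
  assumes n: "n > 0" and T: "sl2_triple n (jordan_block n 0) H F" and "tr H = 0"
  shows "\<exists>W W'. principal_triple n (jordan_block n 0) H F W W'"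
proof -
  let ?J = "jordan_block n 0 :: complex mat"
  interpret T: sl2_triple n ?J H F by fact
  define v where "v = (\<lambda>i. ((\<lambda>u. F *\<^sub>v u) ^^ i) (unit_vec n 0))"
  have v_Suc: "v (Suc i) = F *\<^sub>v v i" for i by (simp add: v_def)
  have v_closed [simp]: "v i \<in> carrier_vec n" for i by (induction i) (auto simp: v_def intro!: mult_mat_vec_carrier[of _ n n])
  have H_col: "H $$ (r, 0) = (if r = 0 then of_nat n - 1 else 0)" if "r < n" for r
    by (rule jordan_weight_first_col[OF n T.H_closed T.lb_H_E assms(3) that])
  have H0v: "H *\<^sub>v v 0 = (of_nat n - 1) \<cdot>\<^sub>v v 0"
  proof (rule eq_vecI)
    fix r assume "r < dim_vec ((of_nat n - 1) \<cdot>\<^sub>v v 0)"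
    hence r: "r < n" by (simp add: v_def)
    have "(H *\<^sub>v v 0) $ r = row H r \<bullet> unit_vec n 0"
      using r carrier_matD[OF T.H_closed] by (simp add: v_def del: scalar_prod_right_unit)
    also have "\<dots> = H $$ (r, 0)" using r n carrier_matD[OF T.H_closed] by simp
    finally show "(H *\<^sub>v v 0) $ r = ((of_nat n - 1) \<cdot>\<^sub>v v 0) $ r"
      using r n by (auto simp: H_col v_def)
  qed (use carrier_matD[OF T.H_closed] in \<open>auto simp: v_def\<close>)
  have Hv: "H *\<^sub>v v i = (of_nat n - 1 - 2 * of_nat i) \<cdot>\<^sub>v v i" for i
  proof (induction i)
    case (Suc i)
    have "H *\<^sub>v v (Suc i) = F *\<^sub>v (H *\<^sub>v v i) + ((-2) \<cdot>\<^sub>m F) *\<^sub>v v i"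
      by (simp add: v_Suc mult_vec_commutator[of H F] T.lb_H_F)
    also have "\<dots> = (of_nat n - 1 - 2 * of_nat i) \<cdot>\<^sub>v v (Suc i) + (-2) \<cdot>\<^sub>v v (Suc i)"
      by (simp add: Suc.IH smult_mult_vec mult_mat_vec[of _ n n] v_Suc)
    also have "\<dots> = (of_nat n - 1 - 2 * of_nat (Suc i)) \<cdot>\<^sub>v v (Suc i)"
      by (simp add: add_smult_distrib_vec[symmetric] algebra_simps)
    finally show ?case .
  qed (simp add: H0v)
  have index_J: "(?J *\<^sub>v u) $ r = (if Suc r < n then u $ Suc r else 0)"
    if "u \<in> carrier_vec n" "r < n" for u r
  proof -
    have "(?J *\<^sub>v u) $ r = (\<Sum>k<n. ?J $$ (r, k) * u $ k)"
      using that by (simp add: scalar_prod_def lessThan_atLeast0)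
    also have "\<dots> = (\<Sum>k<n. if k = Suc r then u $ Suc r else 0)"
      using that by (intro sum.cong) auto
    finally have "(?J *\<^sub>v u) $ r = \<dots>" .
    thus ?thesis by auto
  qed
  \<comment> \<open>The analogue of \<open>lb_E_g\<close> on vectors, with highest weight n-1; these
    are the entries of \<open>E0\<close>.\<close>
  have Jv: "?J *\<^sub>v v i = (of_nat i * (of_nat n - of_nat i)) \<cdot>\<^sub>v v (i - 1)" for i
  proof (induction i)
    case 0
    show ?case
    proof (rule eq_vecI)
      fix r assume "r < dim_vec ((of_nat 0 * (of_nat n - of_nat 0)) \<cdot>\<^sub>v v (0 - 1))"
      hence "r < n" by (simp add: v_def)
      thus "(?J *\<^sub>v v 0) $ r = ((of_nat 0 * (of_nat n - of_nat 0)) \<cdot>\<^sub>v v (0 - 1)) $ r"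
        using index_J[of "v 0" r] by (auto simp: v_def)
    qed (simp add: v_def)
  next
    case (Suc i)
    have *: "F *\<^sub>v ((of_nat i * (of_nat n - of_nat i)) \<cdot>\<^sub>v v (i - 1)) = (of_nat i * (of_nat n - of_nat i)) \<cdot>\<^sub>v v i"
    proof (cases i)
      case 0
      have "F *\<^sub>v (0 \<cdot>\<^sub>v v 0) = 0 \<cdot>\<^sub>v (F *\<^sub>v v 0)" by (simp add: mult_mat_vec[of _ n n])
      also have "\<dots> = 0 \<cdot>\<^sub>v v 0" by (intro eq_vecI) (simp_all add: carrier_matD[OF T.F_closed] carrier_vecD[OF v_closed])
      finally show ?thesis using 0 by simp
    qed (simp add: mult_mat_vec[of _ n n] v_Suc)
    have "?J *\<^sub>v v (Suc i) = F *\<^sub>v (?J *\<^sub>v v i) + H *\<^sub>v v i"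
      by (simp add: v_Suc mult_vec_commutator[of ?J F] T.lb_E_F)
    also have "\<dots> = (of_nat i * (of_nat n - of_nat i)) \<cdot>\<^sub>v v i + (of_nat n - 1 - 2 * of_nat i) \<cdot>\<^sub>v v i"
      unfolding Suc.IH * Hv ..
    also have "\<dots> = (of_nat (Suc i) * (of_nat n - of_nat (Suc i))) \<cdot>\<^sub>v v (Suc i - 1)"
      by (simp add: add_smult_distrib_vec[symmetric] algebra_simps)
    finally show ?case .
  qed
  have v_up: "v (Suc i) $ Suc r = of_nat (Suc i) * (of_nat n - of_nat (Suc i)) * v i $ r"
    if "Suc r < n" for i r
    using index_J[of "v (Suc i)" r] that Jv[of "Suc i"] v_closed[of i] by auto
  have v_tri: "v i $ r = 0" if "i < r" "r < n" for i r
    using that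
  proof (induction i arbitrary: r)
    case 0
    thus ?case by (simp add: v_def)
  next
    case (Suc i)
    then obtain r' where "r = Suc r'" by (cases r) auto
    thus ?case using Suc by (simp add: v_up)
  qed
  have v_diag: "v i $ i \<noteq> 0" if "i < n" for i
    using that
  proof (induction i)
    case 0
    thus ?case by (simp add: v_def)
  next
    case (Suc i)
    have "(of_nat n :: complex) \<noteq> of_nat (Suc i)" using Suc.prems by (simp only: of_nat_eq_iff)
    moreover have "(of_nat (Suc i) :: complex) \<noteq> 0" by (simp only: of_nat_eq_0_iff)
    ultimately show ?case using Suc by (simp only: v_up mult_eq_0_iff) simp
  qed
  \<comment> \<open>The factor n - n in \<open>v_up\<close> kills all entries but the top one. With
    only that entry left, the first column of H gives it the eigenvalue n-1, while \<open>Hv\<close>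
    gives n-1-2n, so it is zero too.\<close>
  have v_n: "v n $ r = 0" if "r < n" for r
  proof (cases r)
    case (Suc r')
    obtain n' where n': "n = Suc n'" using n by (cases n) auto
    show ?thesis using v_up[of r' n'] that Suc by (simp add: n'[symmetric])
  next
    case 0
    have z: "v n $ Suc s = 0" if "Suc s < n" for s
    proof -
      obtain n' where n': "n = Suc n'" using n by (cases n) auto
      show ?thesis using v_up[of s n'] that by (simp add: n'[symmetric])
    qed
    have "(H *\<^sub>v v n) $ 0 = (\<Sum>k<n. H $$ (0, k) * v n $ k)"
      using n by (simp add: scalar_prod_def lessThan_atLeast0 carrier_matD[OF T.H_closed] carrier_vecD[OF v_closed])
    also have "\<dots> = (\<Sum>k<n. if k = 0 then (of_nat n - 1) * v n $ 0 else 0)"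
      using H_col[OF n] z by (intro sum.cong refl) (auto simp: gr0_conv_Suc)
    also have "\<dots> = (of_nat n - 1) * v n $ 0" using n by simp
    finally have "(of_nat n - 1 - 2 * of_nat n) * v n $ 0 = (of_nat n - 1) * v n $ 0"
      using n by (simp add: Hv carrier_vecD[OF v_closed])
    hence "of_nat n * v n $ 0 = 0" by (simp add: algebra_simps)
    thus ?thesis using 0 n by simp
  qed
  define W where "W = mat n n (\<lambda>(r, i). v i $ r)"
  have W: "W \<in> M" by (simp add: W_def)
  have "det W = prod_list (diag_mat W)"
    by (rule det_upper_triangular[OF _ W]) (auto simp: W_def v_tri)
  also have "\<dots> \<noteq> 0" by (auto simp: prod_list_zero_iff diag_mat_def W_def v_diag)
  finally obtain W' where W': "W' \<in> M" "W' * W = 1\<^sub>m n" "W * W' = 1\<^sub>m n"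
    using det_non_zero_imp_unit[OF W, of "()"] by (auto simp: Units_def ring_mat_def)
  have index_W: "(A * W) $$ (r, c) = (A *\<^sub>v v c) $ r" if "A \<in> M" "r < n" "c < n" for A r c
  proof -
    have "col W c = v c" using that by (intro eq_vecI) (simp_all add: W_def carrier_vecD[OF v_closed])
    thus ?thesis using that W by (simp add: index_mult_mat(1))
  qed
  have "principal_triple n ?J H F W W'"
  proof (rule principal_tripleI[OF T])
    show "conj_mats n W W'" by unfold_locales (use W W' in auto)
    show "?J * W = W * E0"
    proof (rule eq_matI)
      fix r c assume "r < dim_row (W * E0)" "c < dim_col (W * E0)"
      hence rc: "r < n" "c < n" using W by (auto simp: std_dim)
      show "(?J * W) $$ (r, c) = (W * E0) $$ (r, c)"
        unfolding index_W[OF jordan_block_carrier rc] index_mult_E0[OF W rc] Jv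
        using rc by (auto simp: W_def of_nat_diff carrier_vecD[OF v_closed])
    qed (use W in \<open>auto simp: std_dim\<close>)
    show "H * W = W * H0"
    proof (rule eq_matI)
      fix r c assume "r < dim_row (W * H0)" "c < dim_col (W * H0)"
      hence rc: "r < n" "c < n" using W by (auto simp: std_dim)
      show "(H * W) $$ (r, c) = (W * H0) $$ (r, c)"
        unfolding index_W[OF T.H_closed rc] index_mult_H0[OF W rc] Hv
        using rc by (auto simp: W_def carrier_vecD[OF v_closed])
    qed (use W carrier_matD[OF T.H_closed] in \<open>auto simp: std_dim\<close>)
    show "F * W = W * F0"
    proof (rule eq_matI)
      fix r c assume "r < dim_row (W * F0)" "c < dim_col (W * F0)"
      hence rc: "r < n" "c < n" using W by (auto simp: std_dim)
      show "(F * W) $$ (r, c) = (W * F0) $$ (r, c)"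
        unfolding index_W[OF T.F_closed rc] index_mult_F0[OF W rc] v_Suc[symmetric]
      proof (cases "Suc c < n")
        case False
        hence "Suc c = n" using rc by simp
        thus "v (Suc c) $ r = (if Suc c < n then W $$ (r, Suc c) else 0)" using v_n rc by simp
      qed (use rc in \<open>simp add: W_def\<close>)
    qed (use W carrier_matD[OF T.F_closed] in \<open>auto simp: std_dim\<close>)
  qed
  thus ?thesis by blast
qed

text \<open>Two conjugations are composed: \<open>P\<close> and \<open>Q\<close> relate E to its
  Jordan block, and \<open>W\<close> relates the resulting triple to the standard one. The trace of
  H, which fixes the highest weight, survives the first.\<close>

lemma principal_triple_exists:
  assumes n: "n > 0" and "principal_sl2_triple n E H F"
  shows "\<exists>W W'. principal_triple n E H F W W'"
proof -
  let ?J = "jordan_block n 0 :: complex mat"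
  have EHF: "E \<in> M" "H \<in> M" "F \<in> M" and rel: "lie_bracket H E = 2 \<cdot>\<^sub>m E"
    "lie_bracket H F = (-2) \<cdot>\<^sub>m F" "lie_bracket E F = H" and trH: "tr H = 0"
    and sim: "similar_mat E ?J"
    using assms(2) by (auto simp: principal_sl2_triple_def sl_def tr_def principal_nilpotent_def)
  have T: "sl2_triple n E H F" by unfold_locales (use EHF rel in auto)
  obtain P Q where "similar_mat_wit E ?J P Q" using sim by (auto simp: similar_mat_def)
  note PQ = similar_mat_witD2[OF EHF(1) this]
  interpret C: conj_mats n Q P by unfold_locales (use PQ in auto)
  have EJ: "C.cj E = ?J"
    unfolding C.cj_def PQ(3) using PQ(4-7)
    by (simp add: M_assoc PQ(1,2)) (simp add: M_assoc[symmetric] PQ(1,2))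
  have "sl2_triple n ?J (C.cj H) (C.cj F)"
    by unfold_locales (use EHF in \<open>auto simp: EJ[symmetric] C.cj_lb[symmetric] rel C.cj_smult\<close>)
  moreover have "tr (C.cj H) = 0" by (simp add: C.tr_cj EHF trH)
  ultimately obtain W W' where "principal_triple n ?J (C.cj H) (C.cj F) W W'"
    using jordan_principal_triple[OF n] by blast
  then interpret D: principal_triple n ?J "C.cj H" "C.cj F" W W' .
  have "principal_triple n E H F (P * W) (W' * Q)"
  proof (rule principal_tripleI[OF T])
    show "conj_mats n (P * W) (W' * Q)"
    proof
      have "P * W * (W' * Q) = P * (W * W' * Q)" using PQ(6,7) by (simp add: M_assoc)
      thus "P * W * (W' * Q) = 1\<^sub>m n" using PQ(1,7) by (simp add: D.W_W')
      have "W' * Q * (P * W) = W' * (Q * P * W)" using PQ(6,7) by (simp add: M_assoc)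
      thus "W' * Q * (P * W) = 1\<^sub>m n" using PQ(2) by (simp add: D.W'_W)
    qed (use PQ(6,7) in auto)
    have *: "A * (P * W) = P * W * B" if "A \<in> M" "B \<in> M" "C.cj A = D.cj B" for A B
    proof -
      have "A * (P * W) = (P * Q) * (A * (P * W))" using PQ(1,6,7) that(1) by simp
      also have "\<dots> = P * (C.cj A) * W" using PQ(6,7) that(1) by (simp add: M_assoc C.cj_def)
      also have "\<dots> = P * W * B * (W' * W)" unfolding that(3) using PQ(6) that(2) by (simp add: M_assoc D.cj_def)
      also have "\<dots> = P * W * B" using PQ(6) that(2) by (simp add: D.W'_W)
      finally show ?thesis .
    qed
    show "E * (P * W) = P * W * E0" "H * (P * W) = P * W * H0" "F * (P * W) = P * W * F0"
      using EHF by (auto intro!: * simp: EJ D.E_eq[symmetric] D.H_eq[symmetric] D.F_eq[symmetric])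
  qed
  thus ?thesis by blast
qed

end

section \<open>Transvectants and the \<open>sl\<^sub>2\<close>-action on binary forms\<close>

lemma coeff_deriv_x: "coeff (deriv_x P) b = pderiv (coeff P b)"
  by (simp add: deriv_x_def coeff_map_poly)

lemma coeff_coeff_deriv_x: "coeff (coeff (deriv_x P) b) a = of_nat (Suc a) * coeff (coeff P b) (Suc a)"
  by (simp add: coeff_deriv_x coeff_pderiv)

lemma coeff_coeff_deriv_y: "coeff (coeff (deriv_y P) b) a = of_nat (Suc b) * coeff (coeff P (Suc b)) a"
  by (simp add: deriv_y_def coeff_pderiv of_nat_poly del: of_nat_Suc)

lemma deriv_x_add: "deriv_x (P + Q) = deriv_x P + deriv_x Q"
  by (simp add: poly_eq_iff coeff_coeff_deriv_x algebra_simps)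

lemma deriv_y_add: "deriv_y (P + Q) = deriv_y P + deriv_y Q"
  by (simp add: deriv_y_def pderiv_add)

lemma deriv_x_cscale: "deriv_x (cscale c P) = cscale c (deriv_x P)"
  by (simp add: poly_eq_iff coeff_coeff_deriv_x algebra_simps)

lemma deriv_y_cscale: "deriv_y (cscale c P) = cscale c (deriv_y P)"
  by (simp add: deriv_y_def pderiv_smult)

lemma deriv_x_mult: "deriv_x (P * Q) = deriv_x P * Q + P * deriv_x Q"
proof (rule poly_eqI)
  fix b
  have "pderiv (\<Sum>i\<in>A. f i) = (\<Sum>i\<in>A. pderiv (f i))" for f :: "nat \<Rightarrow> complex poly" and A
    by (induction A rule: infinite_finite_induct) (auto simp: pderiv_add)
  moreover have "pderiv (p * q) = pderiv p * q + p * pderiv q" for p q :: "complex poly"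
    by (simp add: pderiv_mult algebra_simps)
  ultimately show "coeff (deriv_x (P * Q)) b = coeff (deriv_x P * Q + P * deriv_x Q) b"
    by (simp add: coeff_deriv_x coeff_mult sum.distrib)
qed

lemma deriv_y_mult: "deriv_y (P * Q) = deriv_y P * Q + P * deriv_y Q"
  by (simp add: deriv_y_def pderiv_mult algebra_simps)

lemma deriv_xy_commute: "deriv_x (deriv_y P) = deriv_y (deriv_x P)"
  by (simp add: poly_eq_iff coeff_coeff_deriv_x coeff_coeff_deriv_y mult_ac del: of_nat_Suc)

lemma deriv_y_funpow_deriv_x: "(deriv_y ^^ k) (deriv_x P) = deriv_x ((deriv_y ^^ k) P)"
  by (induction k) (simp_all add: deriv_xy_commute)

lemma deriv_var [simp]:
  "deriv_x var_x = 1" "deriv_y var_x = 0" "deriv_x var_y = 0" "deriv_y var_y = 1"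
proof -
  have "map_poly pderiv (1 :: complex poly poly) = 0"
    by (rule poly_eqI) (simp add: coeff_map_poly coeff_1)
  thus "deriv_x var_x = 1" "deriv_y var_x = 0" "deriv_x var_y = 0" "deriv_y var_y = 1"
    by (simp_all add: var_x_def var_y_def deriv_x_def deriv_y_def monom_altdef pderiv_pCons map_poly_pCons pCons_one)
qed

lemma sum_alternating_pascal:
  fixes f :: "nat \<Rightarrow> 'a :: comm_ring_1"
  shows "(\<Sum>s=0..Suc m. (-1) ^ s * of_nat (Suc m choose s) * f s) =
    (\<Sum>s=0..m. (-1) ^ s * of_nat (m choose s) * f s) - (\<Sum>s=0..m. (-1) ^ s * of_nat (m choose s) * f (Suc s))"
proof -
  have "(\<Sum>s=0..m. (-1) ^ s * of_nat (m choose s) * f s) = (\<Sum>s=0..Suc m. (-1) ^ s * of_nat (m choose s) * f s)"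
    by (simp add: binomial_eq_0)
  also have "\<dots> = f 0 - (\<Sum>s=0..m. (-1) ^ s * of_nat (m choose Suc s) * f (Suc s))"
    by (subst sum.atLeast0_atMost_Suc_shift) (simp add: sum_negf)
  finally have "(\<Sum>s=0..m. (-1) ^ s * of_nat (m choose s) * f s) = \<dots>" .
  moreover have "(\<Sum>s=0..Suc m. (-1) ^ s * of_nat (Suc m choose s) * f s) =
      f 0 - (\<Sum>s=0..m. (-1) ^ s * of_nat (m choose s) * f (Suc s) + (-1) ^ s * of_nat (m choose Suc s) * f (Suc s))"
  proof -
    have "(-1) ^ Suc s * of_nat (Suc m choose Suc s) * f (Suc s) =
        - ((-1) ^ s * of_nat (m choose s) * f (Suc s) + (-1) ^ s * of_nat (m choose Suc s) * f (Suc s))" for s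
      by (simp add: algebra_simps)
    thus ?thesis by (subst sum.atLeast0_atMost_Suc_shift) (simp only: o_def sum_negf, simp)
  qed
  ultimately show ?thesis by (simp add: sum.distrib)
qed

lemma transvectant_0: "transvectant 0 P Q = P * Q"
  by (simp add: transvectant_def)

text \<open>The transvectant is the m-th power of Omega, the operator d_x (x) d_y - d_y (x) d_x on
  pairs, followed by multiplication. Peeling off one factor, by Pascal's rule, gives the recursion
  on which the later inductions rest.\<close>

lemma transvectant_Suc:
  "transvectant (Suc m) P Q = transvectant m (deriv_x P) (deriv_y Q) - transvectant m (deriv_y P) (deriv_x Q)"
proof -
  define f where "f s = (deriv_x ^^ (Suc m - s)) ((deriv_y ^^ s) P) * (deriv_x ^^ s) ((deriv_y ^^ (Suc m - s)) Q)" for s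
  have "transvectant (Suc m) P Q = (\<Sum>s=0..Suc m. (-1) ^ s * of_nat (Suc m choose s) * f s)"
    unfolding transvectant_def f_def by (intro sum.cong refl) (simp only: mult.assoc)
  also have "\<dots> = (\<Sum>s=0..m. (-1) ^ s * of_nat (m choose s) * f s) - (\<Sum>s=0..m. (-1) ^ s * of_nat (m choose s) * f (Suc s))"
    by (rule sum_alternating_pascal)
  also have "(\<Sum>s=0..m. (-1) ^ s * of_nat (m choose s) * f s) = transvectant m (deriv_x P) (deriv_y Q)"
    unfolding transvectant_def f_def
    by (intro sum.cong refl) (simp add: Suc_diff_le deriv_y_funpow_deriv_x funpow_swap1 mult.assoc)
  also have "(\<Sum>s=0..m. (-1) ^ s * of_nat (m choose s) * f (Suc s)) = transvectant m (deriv_y P) (deriv_x Q)"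
    unfolding transvectant_def f_def
    by (intro sum.cong refl) (simp add: deriv_y_funpow_deriv_x funpow_swap1 mult.assoc)
  finally show ?thesis .
qed

lemma transvectant_add_left: "transvectant m (P + P') Q = transvectant m P Q + transvectant m P' Q"
  by (induction m arbitrary: P P' Q)
    (simp_all add: transvectant_0 transvectant_Suc deriv_x_add deriv_y_add algebra_simps)

lemma transvectant_add_right: "transvectant m P (Q + Q') = transvectant m P Q + transvectant m P Q'"
  by (induction m arbitrary: P Q Q')
    (simp_all add: transvectant_0 transvectant_Suc deriv_x_add deriv_y_add algebra_simps)

lemma transvectant_cscale_left: "transvectant m (cscale c P) Q = cscale c (transvectant m P Q)"
  by (induction m arbitrary: P Q)
    (simp_all add: transvectant_0 transvectant_Suc deriv_x_cscale deriv_y_cscale smult_diff_right)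

lemma transvectant_cscale_right: "transvectant m P (cscale c Q) = cscale c (transvectant m P Q)"
  by (induction m arbitrary: P Q)
    (simp_all add: transvectant_0 transvectant_Suc deriv_x_cscale deriv_y_cscale smult_diff_right)

lemma transvectant_zero_left [simp]: "transvectant m 0 Q = 0"
  using transvectant_cscale_left[of m 0 0 Q] by simp

section \<open>Equivariance and homogeneity of transvectants\<close>

definition raise :: "complex poly poly \<Rightarrow> complex poly poly" where
  "raise P = var_x * deriv_y P"

definition lower :: "complex poly poly \<Rightarrow> complex poly poly" where
  "lower P = var_y * deriv_x P"

lemma raise_diff: "raise (P - Q) = raise P - raise Q"
  using deriv_y_add[of "P - Q" Q] by (simp add: raise_def algebra_simps)

lemma lower_diff: "lower (P - Q) = lower P - lower Q"
  using deriv_x_add[of "P - Q" Q] by (simp add: lower_def algebra_simps)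

lemma deriv_raise:
  "deriv_x (raise P) = deriv_y P + raise (deriv_x P)" "deriv_y (raise P) = raise (deriv_y P)"
  by (simp_all add: raise_def deriv_x_mult deriv_y_mult deriv_xy_commute)

lemma deriv_lower:
  "deriv_x (lower P) = lower (deriv_x P)" "deriv_y (lower P) = deriv_x P + lower (deriv_y P)"
  by (simp_all add: lower_def deriv_x_mult deriv_y_mult deriv_xy_commute)

text \<open>Omega commutes with the diagonal action: \<open>deriv_raise\<close> contributes an extra
  pair (\<open>deriv_y P\<close>, \<open>deriv_y Q\<close>) from each factor, with opposite signs.
  For \<open>lower\<close> the same happens with \<open>deriv_x\<close>.\<close>

lemma raise_transvectant:
  "raise (transvectant m P Q) = transvectant m (raise P) Q + transvectant m P (raise Q)"
proof (induction m arbitrary: P Q)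
  case 0
  show ?case by (simp add: transvectant_0 raise_def deriv_y_mult algebra_simps)
next
  case (Suc m)
  show ?case
    by (simp add: transvectant_Suc raise_diff Suc.IH deriv_raise transvectant_add_left transvectant_add_right)
qed

lemma lower_transvectant:
  "lower (transvectant m P Q) = transvectant m (lower P) Q + transvectant m P (lower Q)"
proof (induction m arbitrary: P Q)
  case 0
  show ?case by (simp add: transvectant_0 lower_def deriv_x_mult algebra_simps)
next
  case (Suc m)
  show ?case
    by (simp add: transvectant_Suc lower_diff Suc.IH deriv_lower transvectant_add_left transvectant_add_right)
qed

lemma homogeneous_add: "P \<in> homogeneous_polys d \<Longrightarrow> Q \<in> homogeneous_polys d \<Longrightarrow> P + Q \<in> homogeneous_polys d"
  unfolding homogeneous_polys_def by (auto, metis add.right_neutral)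

lemma homogeneous_cscale: "P \<in> homogeneous_polys d \<Longrightarrow> cscale c P \<in> homogeneous_polys d"
  unfolding homogeneous_polys_def by auto

lemma homogeneous_diff:
  "P \<in> homogeneous_polys d \<Longrightarrow> Q \<in> homogeneous_polys d \<Longrightarrow> P - Q \<in> homogeneous_polys d"
  unfolding homogeneous_polys_def by (auto, metis diff_zero)

lemma homogeneous_mult:
  assumes "P \<in> homogeneous_polys p" "Q \<in> homogeneous_polys q"
  shows "P * Q \<in> homogeneous_polys (p + q)"
  unfolding homogeneous_polys_def
proof (safe, rule ccontr)
  fix a b assume nz: "coeff (coeff (P * Q) b) a \<noteq> 0" and ab: "a + b \<noteq> p + q"
  have "coeff (coeff P i) k * coeff (coeff Q (b - i)) (a - k) = 0" if "i \<le> b" "k \<le> a" for i k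
  proof (rule ccontr)
    assume "\<not> ?thesis"
    hence "k + i = p" "a - k + (b - i) = q" using assms by (auto simp: homogeneous_polys_def)
    thus False using ab that by simp
  qed
  hence "coeff (coeff (P * Q) b) a = 0" by (auto simp: coeff_mult coeff_sum intro!: sum.neutral)
  thus False using nz by simp
qed

text \<open>Truncation at \<open>d = 0\<close> is harmless: the derivative is then zero, which lies
  in every \<open>homogeneous_polys\<close>.\<close>

lemma homogeneous_deriv_x: "P \<in> homogeneous_polys d \<Longrightarrow> deriv_x P \<in> homogeneous_polys (d - 1)"
  by (fastforce simp: homogeneous_polys_def coeff_coeff_deriv_x)

lemma homogeneous_deriv_y: "P \<in> homogeneous_polys d \<Longrightarrow> deriv_y P \<in> homogeneous_polys (d - 1)"
  by (fastforce simp: homogeneous_polys_def coeff_coeff_deriv_y)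

lemma homogeneous_transvectant:
  assumes "P \<in> homogeneous_polys p" "Q \<in> homogeneous_polys q" "m \<le> p" "m \<le> q"
  shows "transvectant m P Q \<in> homogeneous_polys (p + q - 2 * m)"
  using assms
proof (induction m arbitrary: P Q p q)
  case 0
  thus ?case by (simp add: transvectant_0 homogeneous_mult)
next
  case (Suc m)
  have deg: "p - 1 + (q - 1) - 2 * m = p + q - 2 * Suc m" using Suc.prems by simp
  have "transvectant m (deriv_x P) (deriv_y Q) \<in> homogeneous_polys (p - 1 + (q - 1) - 2 * m)"
    by (intro Suc.IH homogeneous_deriv_x homogeneous_deriv_y) (use Suc.prems in auto)
  moreover have "transvectant m (deriv_y P) (deriv_x Q) \<in> homogeneous_polys (p - 1 + (q - 1) - 2 * m)"
    by (intro Suc.IH homogeneous_deriv_x homogeneous_deriv_y) (use Suc.prems in auto)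
  ultimately show ?case unfolding transvectant_Suc deg by (rule homogeneous_diff)
qed

text \<open>Product of divided powers of x and y, normalised so that derivatives shift the exponents
  without a factor.\<close>

definition divpow :: "nat \<Rightarrow> nat \<Rightarrow> complex poly poly" where
  "divpow a b = monom (monom (1 / (fact a * fact b)) a) b"

lemma coeff_coeff_divpow:
  "coeff (coeff (divpow a b) b') a' = (if a = a' \<and> b = b' then 1 / (fact a * fact b) else 0)"
  by (simp add: divpow_def)

lemma homogeneous_divpow: "divpow a b \<in> homogeneous_polys (a + b)"
  by (auto simp: homogeneous_polys_def coeff_coeff_divpow split: if_splits)

lemma deriv_x_divpow: "deriv_x (divpow a b) = (if a = 0 then 0 else divpow (a - 1) b)"
  by (cases a) (auto simp: poly_eq_iff coeff_coeff_deriv_x coeff_coeff_divpow simp del: of_nat_Suc)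

lemma deriv_y_divpow: "deriv_y (divpow a b) = (if b = 0 then 0 else divpow a (b - 1))"
  by (cases b) (auto simp: poly_eq_iff coeff_coeff_deriv_y coeff_coeff_divpow simp del: of_nat_Suc)

lemma coeff_var_x_mult: "coeff (coeff (var_x * P) b) a = (if a = 0 then 0 else coeff (coeff P b) (a - 1))"
  by (cases a) (simp_all add: var_x_def monom_altdef)

lemma coeff_var_y_mult: "coeff (coeff (var_y * P) b) a = (if b = 0 then 0 else coeff (coeff P (b - 1)) a)"
  by (cases b) (simp_all add: var_y_def monom_altdef)

lemma raise_divpow: "raise (divpow a b) = (if b = 0 then 0 else cscale (of_nat (Suc a)) (divpow (Suc a) (b - 1)))"
  by (auto simp: raise_def deriv_y_divpow poly_eq_iff coeff_var_x_mult coeff_coeff_divpow simp del: of_nat_Suc)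

lemma lower_divpow: "lower (divpow a b) = (if a = 0 then 0 else cscale (of_nat (Suc b)) (divpow (a - 1) (Suc b)))"
  by (auto simp: lower_def deriv_x_divpow poly_eq_iff coeff_var_y_mult coeff_coeff_divpow simp del: of_nat_Suc)

text \<open>One argument is free of y and the other of x, so the second term of
  \<open>transvectant_Suc\<close> vanishes at each stage.\<close>

lemma transvectant_divpow:
  "m \<le> a \<Longrightarrow> m \<le> b \<Longrightarrow> transvectant m (divpow a 0) (divpow 0 b) = divpow (a - m) (b - m)"
proof (induction m arbitrary: a b)
  case 0
  have "divpow a 0 * divpow 0 b = divpow a b" by (simp add: divpow_def mult_monom)
  thus ?case by (simp add: transvectant_0)
next
  case (Suc m)
  thus ?case by (simp add: transvectant_Suc deriv_x_divpow deriv_y_divpow)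
qed

lemma mpoly_divpow: "mpoly i j = cscale (fact (nat (int i - j))) (divpow (nat (int i + j)) (nat (int i - j)))"
proof -
  have x: "var_x = monom (monom 1 1) 0" by (simp add: var_x_def monom_0)
  have "var_y ^ b * var_x ^ a = monom (monom 1 a) b" for a b
    unfolding x by (simp add: var_y_def monom_power mult_monom)
  thus ?thesis by (simp add: mpoly_def divpow_def smult_monom)
qed

lemma homogeneous_mpoly:
  assumes "j \<in> {- int p..int p}"
  shows "mpoly p j \<in> homogeneous_polys (2 * p)"
proof -
  have "nat (int p + j) + nat (int p - j) = 2 * p" using assms by auto
  thus ?thesis using homogeneous_divpow[of "nat (int p + j)" "nat (int p - j)"]
    by (auto simp: mpoly_divpow homogeneous_polys_def)
qed

section \<open>Comparison of brackets and transvectants\<close>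

context principal_triple begin

text \<open>The inverse of \<open>\<Phi>\<^sub>p\<close>, extended to all polynomials by ignoring the coefficients outside
  degree \<open>2p\<close>.\<close>

definition psi :: "nat \<Rightarrow> complex poly poly \<Rightarrow> complex mat" where
  "psi p P = msum (\<lambda>b. (fact (2 * p - b) * coeff (coeff P b) (2 * p - b)) \<cdot>\<^sub>m g p b) {..2 * p}"

lemma psi_closed [simp, intro]: "psi p P \<in> M"
  by (simp add: psi_def)

lemma psi_add: "psi p (P + Q) = psi p P + psi p Q"
  unfolding psi_def
  by (subst msum_add[symmetric]) (auto simp: smult_add_smult algebra_simps intro!: msum_cong)

lemma psi_cscale: "psi p (cscale c P) = c \<cdot>\<^sub>m psi p P"
  unfolding psi_def by (subst smult_msum) (auto simp: mult_ac intro!: msum_cong)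

lemma psi_zero [simp]: "psi p 0 = 0\<^sub>m n n"
  using psi_cscale[of p 0 0] by simp

lemma psi_divpow:
  assumes "a + b = 2 * p"
  shows "psi p (divpow a b) = (1 / fact b) \<cdot>\<^sub>m g p b"
proof -
  have "2 * p - b = a" using assms by simp
  thus ?thesis unfolding psi_def using assms
    by (subst msum_single[of _ b]) (auto simp: coeff_coeff_divpow)
qed

lemma G_eq_g: "G E F p j = g p (nat (int p - j))"
  by (simp add: G_def g_def)

lemma psi_mpoly:
  assumes "j \<in> {- int p..int p}"
  shows "psi p (mpoly p j) = G E F p j"
proof -
  have "nat (int p + j) + nat (int p - j) = 2 * p" using assms by auto
  thus ?thesis by (simp add: mpoly_divpow psi_cscale psi_divpow G_eq_g)
qed

text \<open>The factor 2p-b produced by \<open>deriv_x\<close> is absorbed by the factorial in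
  \<open>psi\<close>. After the index shift the left side has one extra term, at
  \<open>b = 2p\<close>, which is zero by \<open>g_beyond\<close>.\<close>

lemma lb_F_psi: "lie_bracket F (psi p P) = psi p (lower P)"
proof -
  have "lie_bracket F (psi p P) = msum (\<lambda>b. (fact (2 * p - b) * coeff (coeff P b) (2 * p - b)) \<cdot>\<^sub>m g p (Suc b)) {..2 * p}"
    unfolding psi_def by (subst lb_msum) (auto simp: lb_smult_right lb_F_g)
  also have "\<dots> = psi p (lower P)"
    unfolding psi_def
  proof (rule msum_eqI)
    fix i j assume ij: "i < n" "j < n"
    let ?c = "\<lambda>b. fact (2 * p - b) * coeff (coeff P b) (2 * p - b)"
    let ?d = "\<lambda>b. fact (2 * p - b) * coeff (coeff (lower P) b) (2 * p - b)"
    have "(\<Sum>b\<le>2 * p. (?d b \<cdot>\<^sub>m g p b) $$ (i, j)) = (\<Sum>b\<le>2 * p. ?d b * g p b $$ (i, j))"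
      using ij carrier_matD[OF g_closed] by simp
    also have "\<dots> = (\<Sum>b<2 * p. ?d (Suc b) * g p (Suc b) $$ (i, j))"
      by (subst sum.atMost_shift) (simp add: lower_def coeff_var_y_mult)
    also have "\<dots> = (\<Sum>b<2 * p. ?c b * g p (Suc b) $$ (i, j))"
    proof (intro sum.cong refl)
      fix b assume "b \<in> {..<2 * p}"
      then obtain a where "2 * p - b = Suc a" "2 * p - Suc b = a" by (metis Suc_diff_Suc lessThan_iff)
      thus "?d (Suc b) * g p (Suc b) $$ (i, j) = ?c b * g p (Suc b) $$ (i, j)"
        by (simp add: lower_def coeff_var_y_mult coeff_coeff_deriv_x)
    qed
    also have "\<dots> = (\<Sum>b\<le>2 * p. ?c b * g p (Suc b) $$ (i, j))"
      using ij by (simp add: lessThan_Suc_atMost[symmetric] g_beyond)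
    also have "\<dots> = (\<Sum>b\<le>2 * p. (?c b \<cdot>\<^sub>m g p (Suc b)) $$ (i, j))"
      using ij carrier_matD[OF g_closed] by simp
    finally show "(\<Sum>b\<le>2 * p. (?c b \<cdot>\<^sub>m g p (Suc b)) $$ (i, j)) = (\<Sum>b\<le>2 * p. (?d b \<cdot>\<^sub>m g p b) $$ (i, j))" ..
  qed
  finally show ?thesis .
qed

text \<open>At index b+1 the coefficient of \<open>lb_E_g\<close> is (b+1)(2p-b): the first factor
  comes from \<open>deriv_y\<close>, the second completes the factorial. Both boundary terms vanish,
  since \<open>lb_E_g\<close> has factor 0 at \<open>b = 0\<close> and \<open>raise P\<close> is
  divisible by x.\<close>

lemma lb_E_psi: "lie_bracket E (psi p P) = psi p (raise P)"
proof -
  have "lie_bracket E (psi p P) = msum (\<lambda>b. (fact (2 * p - b) * coeff (coeff P b) (2 * p - b)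
      * (of_nat b * (2 * of_nat p - of_nat b + 1))) \<cdot>\<^sub>m g p (b - 1)) {..2 * p}"
    unfolding psi_def by (subst lb_msum) (auto simp: lb_smult_right lb_E_g)
  also have "\<dots> = psi p (raise P)"
    unfolding psi_def
  proof (rule msum_eqI)
    fix i j assume ij: "i < n" "j < n"
    let ?c = "\<lambda>b. fact (2 * p - b) * coeff (coeff P b) (2 * p - b) * (of_nat b * (2 * of_nat p - of_nat b + 1))"
    let ?d = "\<lambda>b. fact (2 * p - b) * coeff (coeff (raise P) b) (2 * p - b)"
    have "(\<Sum>b\<le>2 * p. (?c b \<cdot>\<^sub>m g p (b - 1)) $$ (i, j)) = (\<Sum>b\<le>2 * p. ?c b * g p (b - 1) $$ (i, j))"
      using ij carrier_matD[OF g_closed] by simp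
    also have "\<dots> = (\<Sum>b<2 * p. ?c (Suc b) * g p b $$ (i, j))"
      by (subst sum.atMost_shift) simp
    also have "\<dots> = (\<Sum>b<2 * p. ?d b * g p b $$ (i, j))"
    proof (intro sum.cong refl)
      fix b assume b: "b \<in> {..<2 * p}"
      then obtain a where a: "2 * p - b = Suc a" "2 * p - Suc b = a" by (metis Suc_diff_Suc lessThan_iff)
      hence "2 * p = b + Suc a" using b by simp
      hence "2 * of_nat p = (of_nat b + of_nat (Suc a) :: complex)"
        by (metis of_nat_add of_nat_mult of_nat_numeral)
      thus "?c (Suc b) * g p b $$ (i, j) = ?d b * g p b $$ (i, j)"
        using a by (simp add: raise_def coeff_var_x_mult coeff_coeff_deriv_y)
    qed
    also have "\<dots> = (\<Sum>b\<le>2 * p. ?d b * g p b $$ (i, j))"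
      by (simp add: lessThan_Suc_atMost[symmetric] raise_def coeff_var_x_mult)
    also have "\<dots> = (\<Sum>b\<le>2 * p. (?d b \<cdot>\<^sub>m g p b) $$ (i, j))"
      using ij carrier_matD[OF g_closed] by simp
    finally show "(\<Sum>b\<le>2 * p. (?c b \<cdot>\<^sub>m g p (b - 1)) $$ (i, j)) = (\<Sum>b\<le>2 * p. (?d b \<cdot>\<^sub>m g p b) $$ (i, j))" .
  qed
  finally show ?thesis .
qed

section \<open>Identification of \<open>psi\<close> with \<open>Phi_inv\<close>\<close>

text \<open>Induction on the y-degree: \<open>raise\<close> lowers it and corresponds to
  \<open>ad E\<close>, so \<open>raise P = 0\<close>, and \<open>P\<close> is free of y. Then
  \<open>psi p P\<close> is a multiple of the p-th power of E, nonzero for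
  \<open>p < n\<close>.\<close>

lemma psi_eq_zeroD:
  assumes "p < n" "P \<in> homogeneous_polys (2 * p)" "psi p P = 0\<^sub>m n n"
  shows "P = 0"
proof -
  have "P = 0" if "P \<in> homogeneous_polys (2 * p)" "psi p P = 0\<^sub>m n n" "\<And>b. b > k \<Longrightarrow> coeff P b = 0" for k P
    using that
  proof (induction k arbitrary: P)
    case 0
    have "psi p P = (fact (2 * p) * coeff (coeff P 0) (2 * p)) \<cdot>\<^sub>m g p 0"
      unfolding psi_def using 0(3) by (subst msum_single[of _ 0]) auto
    from this[symmetric] 0(2) have "(fact (2 * p) * coeff (coeff P 0) (2 * p)) \<cdot>\<^sub>m g p 0 = 0\<^sub>m n n"
      by (rule trans)
    hence "coeff (coeff P 0) (2 * p) = 0"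
      using E_pow_nonzero[OF assms(1)] unfolding smult_eq_zero_iff[OF g_closed] by (simp add: g_0)
    moreover have "coeff (coeff P 0) a = 0" if "a \<noteq> 2 * p" for a
      using 0(1) that unfolding homogeneous_polys_def by fastforce
    ultimately have "coeff (coeff P b) a = 0" for a b
      using 0(3)[of b] by (cases "b = 0"; cases "a = 2 * p") auto
    thus ?case by (simp add: poly_eq_iff)
  next
    case (Suc k)
    have "raise P = 0"
    proof (rule Suc.IH)
      have "a + b = 2 * p" if "coeff (coeff (raise P) b) a \<noteq> 0" for a b
      proof -
        have "a \<noteq> 0" "coeff (coeff P (Suc b)) (a - 1) \<noteq> 0"
          using that by (auto simp: raise_def coeff_var_x_mult coeff_coeff_deriv_y split: if_splits)
        moreover from this have "a - 1 + Suc b = 2 * p"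
          using Suc.prems(1) unfolding homogeneous_polys_def by blast
        ultimately show ?thesis by simp
      qed
      thus "raise P \<in> homogeneous_polys (2 * p)" by (simp add: homogeneous_polys_def)
      show "psi p (raise P) = 0\<^sub>m n n" using Suc.prems(2) by (simp add: lb_E_psi[symmetric])
      show "coeff (raise P) b = 0" if "b > k" for b
        using Suc.prems(3)[of "Suc b"] that
        by (auto simp: poly_eq_iff raise_def coeff_var_x_mult coeff_coeff_deriv_y)
    qed
    have "coeff (coeff P (Suc b)) a = 0" for a b
    proof -
      have "coeff (coeff (raise P) b) (Suc a) = 0" by (simp add: \<open>raise P = 0\<close>)
      thus ?thesis by (simp add: raise_def coeff_var_x_mult coeff_coeff_deriv_y del: of_nat_Suc)
    qed
    hence "coeff P b = 0" if "b > 0" for b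
      using that by (cases b) (auto simp: poly_eq_iff)
    thus ?case using Suc.IH[OF Suc.prems(1,2)] by auto
  qed
  from this[OF assms(2,3), of "degree P"] show ?thesis by (simp add: coeff_eq_0)
qed

lemma psi_inj: "p < n \<Longrightarrow> inj_on (psi p) (homogeneous_polys (2 * p))"
proof (rule inj_onI)
  fix P Q assume p: "p < n" and PQ: "P \<in> homogeneous_polys (2 * p)" "Q \<in> homogeneous_polys (2 * p)" "psi p P = psi p Q"
  have "psi p (P + cscale (-1) Q) = psi p Q + (-1) \<cdot>\<^sub>m psi p Q" by (simp only: psi_add psi_cscale PQ(3))
  also have "\<dots> = 0\<^sub>m n n" using carrier_matD[OF psi_closed] by (intro eq_matI) auto
  finally have "P + cscale (-1) Q = 0"
    using psi_eq_zeroD[OF p] homogeneous_add[OF PQ(1) homogeneous_cscale[OF PQ(2)]] by blast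
  moreover have "cscale (-1) Q = - Q" by (simp add: poly_eq_iff)
  ultimately show "P = Q" by simp
qed

lemma psi_image: "psi p ` homogeneous_polys (2 * p) = V n E F p"
proof
  have GM: "G E F p ` {- int p..int p} \<subseteq> M" by (auto simp: G_eq_g)
  note span = span_submodule[OF GM, folded V_def]
  have g_V: "g p b \<in> V n E F p" if "b \<le> 2 * p" for b
  proof -
    have "g p b = G E F p (int p - int b)" by (simp add: G_eq_g)
    thus ?thesis using span(2) that by (auto simp: image_subset_iff)
  qed
  have msum_V: "msum f S \<in> V n E F p" if "finite S" "\<And>s. s \<in> S \<Longrightarrow> f s \<in> V n E F p" for f and S :: "nat set"
  proof -
    have VM: "V n E F p \<subseteq> M"
      using submodule.subset[OF span(1)] by (simp add: module_mat_simps)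
    show ?thesis using that
      by (induction S rule: finite_induct) (auto simp: subsetD[OF VM] span(3,4))
  qed
  show "psi p ` homogeneous_polys (2 * p) \<subseteq> V n E F p"
    unfolding psi_def by (auto intro!: msum_V span(5) g_V)
  show "V n E F p \<subseteq> psi p ` homogeneous_polys (2 * p)"
    unfolding V_def
  proof (rule span_least)
    show "G E F p ` {- int p..int p} \<subseteq> psi p ` homogeneous_polys (2 * p)"
      using psi_mpoly homogeneous_mpoly by (metis (no_types, lifting) image_eqI image_subsetI)
    show "0\<^sub>m n n \<in> psi p ` homogeneous_polys (2 * p)"
      by (rule image_eqI[of _ _ 0]) (auto simp: homogeneous_polys_def)
  next
    fix A B assume "A \<in> psi p ` homogeneous_polys (2 * p)" "B \<in> psi p ` homogeneous_polys (2 * p)"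
    thus "A + B \<in> psi p ` homogeneous_polys (2 * p)"
      by (auto simp: psi_add[symmetric] intro!: imageI homogeneous_add)
  next
    fix c A assume "A \<in> psi p ` homogeneous_polys (2 * p)"
    thus "c \<cdot>\<^sub>m A \<in> psi p ` homogeneous_polys (2 * p)"
      by (auto simp: psi_cscale[symmetric] intro!: imageI homogeneous_cscale)
  qed auto
qed

text \<open>The description defining \<open>Phi\<close> needs existence and uniqueness. The inverse
  of \<open>psi p\<close> on its image is a solution; any other one agrees with it on the
  generators, hence on their span, and outside by extensionality.\<close>

lemma Phi_psi:
  assumes p: "p < n" and P: "P \<in> homogeneous_polys (2 * p)"
  shows "Phi n E F p (psi p P) = P" "psi p P \<in> V n E F p" "inj_on (Phi n E F p) (V n E F p)"
proof -
  let ?hom = "homogeneous_polys (2 * p)" and ?V = "V n E F p"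
  define is_Phi where "is_Phi \<phi> \<longleftrightarrow>
     \<phi> \<in> extensional ?V \<and>
     (\<forall>A\<in>?V. \<forall>B\<in>?V. \<phi> (A + B) = \<phi> A + \<phi> B) \<and>
     (\<forall>c. \<forall>A\<in>?V. \<phi> (c \<cdot>\<^sub>m A) = cscale c (\<phi> A)) \<and>
     bij_betw \<phi> ?V ?hom \<and>
     (\<forall>j\<in>{- int p..int p}. \<phi> (G E F p j) = mpoly p j)" for \<phi>
  define \<phi> where "\<phi> = restrict (inv_into ?hom (psi p)) ?V"
  have psi_V: "psi p Q \<in> ?V" if "Q \<in> ?hom" for Q using psi_image that by blast
  have \<phi>_psi: "\<phi> (psi p Q) = Q" if "Q \<in> ?hom" for Q
    unfolding \<phi>_def using that psi_V[OF that] psi_inj[OF p] by (simp add: inv_into_f_f)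
  have bij: "bij_betw \<phi> ?V ?hom"
    unfolding \<phi>_def using psi_inj[OF p] psi_image[of p]
    by (intro bij_betw_cong[THEN iffD1, OF _ bij_betw_inv_into[of "psi p"]]) (auto simp: bij_betw_def)
  have "is_Phi \<phi>"
    unfolding is_Phi_def
  proof (intro conjI ballI allI)
    show "\<phi> \<in> extensional ?V" by (simp add: \<phi>_def)
  next
    fix A B assume "A \<in> ?V" "B \<in> ?V"
    then obtain P Q where "P \<in> ?hom" "Q \<in> ?hom" "A = psi p P" "B = psi p Q" using psi_image by blast
    thus "\<phi> (A + B) = \<phi> A + \<phi> B" by (simp add: psi_add[symmetric] \<phi>_psi homogeneous_add)
  next
    fix c A assume "A \<in> ?V"
    then obtain P where "P \<in> ?hom" "A = psi p P" using psi_image by blast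
    thus "\<phi> (c \<cdot>\<^sub>m A) = cscale c (\<phi> A)" by (simp add: psi_cscale[symmetric] \<phi>_psi homogeneous_cscale)
  next
    fix j assume "j \<in> {- int p..int p}"
    thus "\<phi> (G E F p j) = mpoly p j" using \<phi>_psi homogeneous_mpoly psi_mpoly by metis
  qed (fact bij)
  moreover have "\<theta> = \<phi>" if \<theta>: "is_Phi \<theta>" for \<theta>
  proof (rule extensionalityI)
    show "\<theta> \<in> extensional ?V" using \<theta> by (simp add: is_Phi_def)
    show "\<phi> \<in> extensional ?V" by (simp add: \<phi>_def)
    fix A assume "A \<in> ?V"
    then have A: "A \<in> LinearCombinations.module.span class_ring (mat_space n) (G E F p ` {- int p..int p})"
      by (simp add: V_def)
    have GM: "G E F p ` {- int p..int p} \<subseteq> M" by (auto simp: G_eq_g)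
    note span = span_submodule[OF GM, folded V_def]
    have VM: "?V \<subseteq> M" using submodule.subset[OF span(1)] by (simp add: module_mat_simps)
    have lin: "\<tau> (B + C) = \<tau> B + \<tau> C" "\<tau> (c \<cdot>\<^sub>m B) = cscale c (\<tau> B)" if "is_Phi \<tau>" "B \<in> ?V" "C \<in> ?V" for \<tau> B C c
      using that by (auto simp: is_Phi_def)
    have "LinearCombinations.module.span class_ring (mat_space n) (G E F p ` {- int p..int p}) \<subseteq> {A \<in> ?V. \<theta> A = \<phi> A}"
    proof (rule span_least)
      show "G E F p ` {- int p..int p} \<subseteq> {A \<in> ?V. \<theta> A = \<phi> A}"
        using span(2) \<theta> \<open>is_Phi \<phi>\<close> by (auto simp: is_Phi_def)
      have zero: "\<tau> (0\<^sub>m n n) = 0" if "is_Phi \<tau>" for \<tau>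
        using lin(2)[OF that span(3,3), of 0] by simp
      show "0\<^sub>m n n \<in> {A \<in> ?V. \<theta> A = \<phi> A}"
        using span(3) zero[OF \<theta>] zero[OF \<open>is_Phi \<phi>\<close>] by simp
    qed (use VM span(4,5) lin[OF \<theta>] lin[OF \<open>is_Phi \<phi>\<close>] in auto)
    thus "\<theta> A = \<phi> A" using A by blast
  qed
  ultimately have "Phi n E F p = \<phi>"
    unfolding Phi_def is_Phi_def by (rule the_equality)
  thus "Phi n E F p (psi p P) = P" "inj_on (Phi n E F p) ?V"
    using bij by (auto simp: \<phi>_psi P bij_betw_def)
  show "psi p P \<in> ?V" by (rule psi_V[OF P])
qed

lemma Phi_inv_eq_psi: "p < n \<Longrightarrow> P \<in> homogeneous_polys (2 * p) \<Longrightarrow> Phi_inv n E F p P = psi p P"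
  unfolding Phi_inv_def by (intro inv_into_f_eq Phi_psi)

text \<open>The identity at the highest and the lowest monomial propagates by \<^const>\<open>raise\<close> in the second
  argument, since \<^const>\<open>raise\<close> kills \<open>x\<^bsup>2k\<^esup>\<close>, and then by \<^const>\<open>lower\<close> in the first.\<close>

lemma bracket_psi_decomposition:
  fixes k l :: nat and \<omega> :: "nat \<Rightarrow> complex" and S :: "nat set"
  assumes S: "finite S"
    and base: "lie_bracket (psi k (divpow (2 * k) 0)) (psi l (divpow 0 (2 * l))) =
      msum (\<lambda>m. \<omega> m \<cdot>\<^sub>m psi (k + l - m) (transvectant m (divpow (2 * k) 0) (divpow 0 (2 * l)))) S"
    and ab: "a + b = 2 * k" "a' + b' = 2 * l"
  shows "lie_bracket (psi k (divpow a b)) (psi l (divpow a' b')) =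
      msum (\<lambda>m. \<omega> m \<cdot>\<^sub>m psi (k + l - m) (transvectant m (divpow a b) (divpow a' b'))) S"
proof -
  define L where "L P Q = lie_bracket (psi k P) (psi l Q)" for P Q
  define R where "R P Q = msum (\<lambda>m. \<omega> m \<cdot>\<^sub>m psi (k + l - m) (transvectant m P Q)) S" for P Q
  have closed [simp]: "L P Q \<in> M" "R P Q \<in> M" for P Q by (auto simp: L_def R_def)
  have E: "lie_bracket E (L P Q) = L (raise P) Q + L P (raise Q)"
      "lie_bracket E (R P Q) = R (raise P) Q + R P (raise Q)" for P Q
    using S by (simp_all add: L_def R_def lb_jacobi[of E] lb_E_psi lb_msum lb_smult_right raise_transvectant
        psi_add M_algebra msum_add)
  have F: "lie_bracket F (L P Q) = L (lower P) Q + L P (lower Q)"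
      "lie_bracket F (R P Q) = R (lower P) Q + R P (lower Q)" for P Q
    using S by (simp_all add: L_def R_def lb_jacobi[of F] lb_F_psi lb_msum lb_smult_right lower_transvectant
        psi_add M_algebra msum_add)
  have scale: "L (cscale c P) Q = c \<cdot>\<^sub>m L P Q" "R (cscale c P) Q = c \<cdot>\<^sub>m R P Q"
      "L P (cscale c Q) = c \<cdot>\<^sub>m L P Q" "R P (cscale c Q) = c \<cdot>\<^sub>m R P Q" for c P Q
    using S by (simp_all add: L_def R_def psi_cscale lb_smult_left lb_smult_right smult_msum
        transvectant_cscale_left transvectant_cscale_right mult.commute)
  have zero: "L 0 Q = R 0 Q" "L P 0 = R P 0" for P Q
    using scale(1,2)[of 0 0 Q] scale(3,4)[of P 0 0] by simp_all
  have cancel: "L P Q = R P Q" if "c \<noteq> 0" "L P (cscale c Q) = R P (cscale c Q)" for c P Q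
    using that smult_cancel[of "L P Q" "R P Q" c] by (simp add: scale)
  have cancel': "L P Q = R P Q" if "c \<noteq> 0" "L (cscale c P) Q = R (cscale c P) Q" for c P Q
    using that smult_cancel[of "L P Q" "R P Q" c] by (simp add: scale)
  have up: "L P (raise Q) = R P (raise Q)" if "L P Q = R P Q" "raise P = 0" for P Q
    using E[of P Q] that zero(1)[of Q] add_left_cancel_M[of "L P (raise Q)" "R P (raise Q)" "R 0 Q"]
    by (simp add: comm_add_mat[of _ n n])
  have down: "L (lower P) Q = R (lower P) Q" if "L P Q = R P Q" "L P (lower Q) = R P (lower Q)" for P Q
    using F[of P Q] that add_left_cancel_M[of "L (lower P) Q" "R (lower P) Q" "R P (lower Q)"] by simp
  have highest: "L (divpow (2 * k) 0) (divpow a' b') = R (divpow (2 * k) 0) (divpow a' b')"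
    if "a' + b' = 2 * l" for a' b'
    using that
  proof (induction a' arbitrary: b')
    case 0
    thus ?case using base by (simp add: L_def R_def)
  next
    case (Suc a')
    have *: "L (divpow (2 * k) 0) (raise (divpow a' (Suc b'))) = R (divpow (2 * k) 0) (raise (divpow a' (Suc b')))"
      using Suc by (intro up) (auto simp: raise_divpow)
    show ?case
      by (rule cancel[of "of_nat (Suc a')"]) (use * in \<open>simp_all add: raise_divpow del: of_nat_Suc\<close>)
  qed
  have "L (divpow a b) (divpow a' b') = R (divpow a b) (divpow a' b')"
    if "a + b = 2 * k" "a' + b' = 2 * l" for a b a' b'
    using that
  proof (induction b arbitrary: a a' b')
    case 0
    thus ?case using highest by simp
  next
    case (Suc b)
    \<comment> \<open>By the Leibniz rule \<open>lower\<close> also moves the second argument, so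
      the induction must be general in \<open>a'\<close> and \<open>b'\<close>. For
      \<open>a' = 0\<close> that term is zero.\<close>
    have "L (divpow (Suc a) b) (lower (divpow a' b')) = R (divpow (Suc a) b) (lower (divpow a' b'))"
      using Suc by (cases a') (auto simp: lower_divpow zero scale)
    hence *: "L (lower (divpow (Suc a) b)) (divpow a' b') = R (lower (divpow (Suc a) b)) (divpow a' b')"
      using Suc by (intro down) auto
    show ?case
      by (rule cancel'[of "of_nat (Suc b)"]) (use * in \<open>simp_all add: lower_divpow del: of_nat_Suc\<close>)
  qed
  from this[OF ab] show ?thesis by (simp add: L_def R_def)
qed

text \<open>The value of \<open>\<omega> m\<close> comes from comparing both sides at the extreme
  divided powers: \<open>psi\<close> contributes 1/(2l)! on the left and 1/(2l-m)! on the right,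
  with q = 2l-m matching the two indexings.\<close>

lemma bracket_G_decomposition:
  assumes kl: "1 \<le> l" "l \<le> k" "k < n"
    and c: "lie_bracket (g k 0) (g l (2 * l)) = msum (\<lambda>q. c q \<cdot>\<^sub>m g (k - l + q) q) {1..2 * l - 1}"
    and i: "i \<in> {- int k..int k}" and j: "j \<in> {- int l..int l}"
    and \<omega>: "\<And>m. m \<in> {1..2 * l - 1} \<Longrightarrow> k + l - m < n \<Longrightarrow>
      \<omega> m = c (2 * l - m) * fact (2 * l - m) / fact (2 * l)"
  shows "lie_bracket (G E F k i) (G E F l j) =
    finsum (mat_space n)
      (\<lambda>m. \<omega> m \<cdot>\<^sub>m Phi_inv n E F (k + l - m) (transvectant m (mpoly k i) (mpoly l j)))
      {m \<in> {1..2 * l - 1}. k + l - m < n}"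
proof -
  define S where "S = {m \<in> {1..2 * l - 1}. k + l - m < n}"
  have S: "finite S" by (simp add: S_def)
  have base: "lie_bracket (psi k (divpow (2 * k) 0)) (psi l (divpow 0 (2 * l))) =
      msum (\<lambda>m. \<omega> m \<cdot>\<^sub>m psi (k + l - m) (transvectant m (divpow (2 * k) 0) (divpow 0 (2 * l)))) S"
  proof -
    have "lie_bracket (psi k (divpow (2 * k) 0)) (psi l (divpow 0 (2 * l))) =
        (1 / fact (2 * l)) \<cdot>\<^sub>m msum (\<lambda>q. c q \<cdot>\<^sub>m g (k - l + q) q) {1..2 * l - 1}"
      by (simp add: psi_divpow lb_smult_right c)
    also have "\<dots> = msum (\<lambda>q. (c q / fact (2 * l)) \<cdot>\<^sub>m g (k - l + q) q) {1..2 * l - 1}"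
      by (subst smult_msum) auto
    also have "\<dots> = msum (\<lambda>m. \<omega> m \<cdot>\<^sub>m psi (k + l - m) (transvectant m (divpow (2 * k) 0) (divpow 0 (2 * l)))) S"
    proof (rule msum_eqI)
      fix r s assume rs: "r < n" "s < n"
      have "(\<Sum>q\<in>{1..2 * l - 1}. ((c q / fact (2 * l)) \<cdot>\<^sub>m g (k - l + q) q) $$ (r, s)) =
          (\<Sum>m\<in>{1..2 * l - 1}. ((c (2 * l - m) / fact (2 * l)) \<cdot>\<^sub>m g (k + l - m) (2 * l - m)) $$ (r, s))"
        using kl by (intro sum.reindex_bij_witness[of _ "\<lambda>m. 2 * l - m" "\<lambda>q. 2 * l - q"]) auto
      \<comment> \<open>The omitted terms are zero in the matrix expansion, because powers of E from
        the n-th on vanish.\<close>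
      also have "\<dots> = (\<Sum>m\<in>S. ((c (2 * l - m) / fact (2 * l)) \<cdot>\<^sub>m g (k + l - m) (2 * l - m)) $$ (r, s))"
      proof (rule sum.mono_neutral_right)
        show "\<forall>m\<in>{1..2 * l - 1} - S. ((c (2 * l - m) / fact (2 * l)) \<cdot>\<^sub>m g (k + l - m) (2 * l - m)) $$ (r, s) = 0"
        proof
          fix m assume "m \<in> {1..2 * l - 1} - S"
          hence "g (k + l - m) (2 * l - m) = 0\<^sub>m n n" by (simp add: S_def g_def E_pow_zero not_less)
          thus "((c (2 * l - m) / fact (2 * l)) \<cdot>\<^sub>m g (k + l - m) (2 * l - m)) $$ (r, s) = 0"
            using rs by simp
        qed
      qed (auto simp: S_def)
      also have "\<dots> = (\<Sum>m\<in>S. (\<omega> m \<cdot>\<^sub>m psi (k + l - m)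
          (transvectant m (divpow (2 * k) 0) (divpow 0 (2 * l)))) $$ (r, s))"
      proof (intro sum.cong refl)
        fix m assume m: "m \<in> S"
        have "transvectant m (divpow (2 * k) 0) (divpow 0 (2 * l)) = divpow (2 * k - m) (2 * l - m)"
          using m kl by (intro transvectant_divpow) (auto simp: S_def)
        moreover have "psi (k + l - m) (divpow (2 * k - m) (2 * l - m)) =
            (1 / fact (2 * l - m)) \<cdot>\<^sub>m g (k + l - m) (2 * l - m)"
          using m kl by (intro psi_divpow) (auto simp: S_def)
        ultimately show "((c (2 * l - m) / fact (2 * l)) \<cdot>\<^sub>m g (k + l - m) (2 * l - m)) $$ (r, s) =
            (\<omega> m \<cdot>\<^sub>m psi (k + l - m) (transvectant m (divpow (2 * k) 0) (divpow 0 (2 * l)))) $$ (r, s)"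
          using \<omega>[of m] m by (simp add: S_def)
      qed
      finally show "(\<Sum>q\<in>{1..2 * l - 1}. ((c q / fact (2 * l)) \<cdot>\<^sub>m g (k - l + q) q) $$ (r, s)) = \<dots>" .
    qed
    finally show ?thesis .
  qed
  define a b a' b' where ab_def: "a = nat (int k + i)" "b = nat (int k - i)" "a' = nat (int l + j)" "b' = nat (int l - j)"
  have ab: "a + b = 2 * k" "a' + b' = 2 * l" using i j by (auto simp: ab_def)
  have "lie_bracket (G E F k i) (G E F l j) =
      (fact b * fact b') \<cdot>\<^sub>m lie_bracket (psi k (divpow a b)) (psi l (divpow a' b'))"
    unfolding psi_mpoly[OF i, symmetric] psi_mpoly[OF j, symmetric]
    by (simp add: mpoly_divpow psi_cscale lb_smult_left lb_smult_right ab_def mult.commute)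
  also have "\<dots> = msum (\<lambda>m. \<omega> m \<cdot>\<^sub>m psi (k + l - m) (transvectant m (mpoly k i) (mpoly l j))) S"
    unfolding bracket_psi_decomposition[OF S base ab]
    using S by (simp add: smult_msum mpoly_divpow transvectant_cscale_left transvectant_cscale_right
      psi_cscale ab_def mult_ac)
  also have "\<dots> = msum (\<lambda>m. \<omega> m \<cdot>\<^sub>m Phi_inv n E F (k + l - m) (transvectant m (mpoly k i) (mpoly l j))) S"
  proof (rule msum_cong)
    fix m assume m: "m \<in> S"
    have "transvectant m (mpoly k i) (mpoly l j) \<in> homogeneous_polys (2 * k + 2 * l - 2 * m)"
      using m kl by (intro homogeneous_transvectant homogeneous_mpoly i j) (auto simp: S_def)
    moreover have "2 * k + 2 * l - 2 * m = 2 * (k + l - m)" by simp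
    ultimately have "Phi_inv n E F (k + l - m) (transvectant m (mpoly k i) (mpoly l j)) =
        psi (k + l - m) (transvectant m (mpoly k i) (mpoly l j))"
      using m by (intro Phi_inv_eq_psi) (auto simp: S_def)
    thus "\<omega> m \<cdot>\<^sub>m psi (k + l - m) (transvectant m (mpoly k i) (mpoly l j)) =
        \<omega> m \<cdot>\<^sub>m Phi_inv n E F (k + l - m) (transvectant m (mpoly k i) (mpoly l j))" by simp
  qed
  also have "\<dots> = finsum (mat_space n)
      (\<lambda>m. \<omega> m \<cdot>\<^sub>m Phi_inv n E F (k + l - m) (transvectant m (mpoly k i) (mpoly l j))) S"
  proof (rule finsum_eq_msum[symmetric, OF S])
    fix m assume m: "m \<in> S"
    have "transvectant m (mpoly k i) (mpoly l j) \<in> homogeneous_polys (2 * k + 2 * l - 2 * m)"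
      using m kl by (intro homogeneous_transvectant homogeneous_mpoly i j) (auto simp: S_def)
    hence "transvectant m (mpoly k i) (mpoly l j) \<in> homogeneous_polys (2 * (k + l - m))"
      by (simp add: diff_mult_distrib2 algebra_simps)
    thus "\<omega> m \<cdot>\<^sub>m Phi_inv n E F (k + l - m) (transvectant m (mpoly k i) (mpoly l j)) \<in> M"
      using m by (subst Phi_inv_eq_psi) (auto simp: S_def)
  qed
  finally show ?thesis unfolding S_def .
qed

end

theorem theorem1p2:
  fixes n :: nat
  assumes "n \<ge> 2"
  shows "\<exists>\<omega> :: nat \<Rightarrow> nat \<Rightarrow> nat \<Rightarrow> complex.
    (\<forall>k l m. 1 \<le> l \<and> l \<le> k \<and> k \<le> n - 1 \<and> 1 \<le> m \<and> m \<le> 2 * l - 1 \<and> k + l - m \<ge> n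
        \<longrightarrow> \<omega> k l m = 0) \<and>
    (\<forall>E H F. principal_sl2_triple n E H F \<longrightarrow>
      (\<forall>k l. 1 \<le> l \<and> l \<le> k \<and> k \<le> n - 1 \<longrightarrow>
        (\<forall>i\<in>{- int k..int k}. \<forall>j\<in>{- int l..int l}.
          lie_bracket (G E F k i) (G E F l j) =
            finsum (mat_space n)
              (\<lambda>m. \<omega> k l m \<cdot>\<^sub>m
                 Phi_inv n E F (k + l - m) (transvectant m (mpoly k i) (mpoly l j)))
              {m \<in> {1..2 * l - 1}. k + l - m < n})))"
proof -
  interpret square_mats n .
  define expands where "expands k l c \<longleftrightarrow> (\<forall>E H F W W'. principal_triple n E H F W W' \<longrightarrow>
      lie_bracket (E ^\<^sub>m k) ((lie_bracket F ^^ (2 * l)) (E ^\<^sub>m l)) =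
        msum (\<lambda>q. c q \<cdot>\<^sub>m (lie_bracket F ^^ q) (E ^\<^sub>m (k - l + q))) {1..2 * l - 1})" for k l c
  \<comment> \<open>The range conditions stand under the existential so that \<open>c\<close> can be
    chosen as a total function of \<open>k\<close> and \<open>l\<close>.\<close>
  have "\<forall>k l. \<exists>c. 1 \<le> l \<and> l \<le> k \<and> k < n \<longrightarrow> expands k l c"
    unfolding expands_def using universal_bracket_expansion by blast
  then obtain c where c: "1 \<le> l \<Longrightarrow> l \<le> k \<Longrightarrow> k < n \<Longrightarrow> expands k l (c k l)" for k l
    by metis
  define \<omega> where "\<omega> k l m = (if k + l - m \<ge> n then 0 else c k l (2 * l - m) * fact (2 * l - m) / fact (2 * l))" for k l m
  show ?thesis
  proof (intro exI[of _ \<omega>] conjI allI impI ballI)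
    fix E H F k l i j
    assume "principal_sl2_triple n E H F" and kl: "1 \<le> l \<and> l \<le> k \<and> k \<le> n - 1"
      and ij: "i \<in> {- int k..int k}" "j \<in> {- int l..int l}"
    then obtain W W' where T: "principal_triple n E H F W W'"
      using principal_triple_exists[of E H F] assms by auto
    interpret principal_triple n E H F W W' by (rule T)
    have kl': "1 \<le> l" "l \<le> k" "k < n" using kl assms by auto
    have expansion: "lie_bracket (g k 0) (g l (2 * l)) =
        msum (\<lambda>q. c k l q \<cdot>\<^sub>m g (k - l + q) q) {1..2 * l - 1}"
      using c[OF kl'] T unfolding expands_def g_def funpow_0 by blast
    show "lie_bracket (G E F k i) (G E F l j) =
            finsum (mat_space n)
              (\<lambda>m. \<omega> k l m \<cdot>\<^sub>m
                 Phi_inv n E F (k + l - m) (transvectant m (mpoly k i) (mpoly l j)))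
              {m \<in> {1..2 * l - 1}. k + l - m < n}"
      by (rule bracket_G_decomposition[OF kl' expansion ij]) (simp add: \<omega>_def)
  qed (simp add: \<omega>_def)
qed

end
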